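(* Let $a\in L^1(I)$. The following identities between Green's functions hold, each one whenever all the boundary value problems whose Green's functions appear in it are nonresonant: 1. $G_N[a,T](t,s)=G_P[\tilde a,2T](t,s)+G_P[\tilde a,2T](t,2T-s)$ for all $(t,s)\in I\times I$. 2. $G_P[\tilde a,2T](t,s)=G_P[\tilde a,2T](2T-t,2T-s)$ for all $(t,s)\in J\times J$. 3. $G_N[a,T](t,s)=G_P[\tilde a,2T](t,s)+G_P[\tilde a,2T](2T-t,s)$ for all $(t,s)\in I\times I$. 4. $G_N[a,T](t,s)=G_N[\tilde a,2T](t,s)+G_N[\tilde a,2T](2T-t,s)$ for all $(t,s)\in I\times I$. 5. $G_N[a,T](t,s)=G_P[\tilde{\tilde a},4T](t,s)+G_P[\tilde{\tilde a},4T](4T-t,s)+G_P[\tilde{\tilde a},4T](2T-t,s)+G_P[\tilde{\tilde a},4T](2T+t,s)$ for all $(t,s)\in I\times I$.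
   Context: Fix $T>0$ and put $I=[0,T]$, $J=[0,2T]$. $W^{2,1}(c,d)$ is the set of $u\in C^1[c,d]$ with $u'$ absolutely continuous on $[c,d]$. For $a\in L^1(I)$, $\tilde a$ is its even extension to $[0,2T]$: $\tilde a(t)=a(t)$ on $[0,T]$, $\tilde a(t)=a(2T-t)$ on $(T,2T]$; and $\tilde{\tilde a}$ is the even extension of $\tilde a$ to $[0,4T]$: $\tilde{\tilde a}(t)=\tilde a(t)$ on $[0,2T]$, $\tilde{\tilde a}(t)=\tilde a(4T-t)$ on $(2T,4T]$. For $S>0$ and $q\in L^1(0,S)$ consider $u''(t)+q(t)u(t)=\sigma(t)$ for a.e. $t\in[0,S]$, $u\in W^{2,1}(0,S)$, with one of the boundary conditions: (P) periodic: $u(0)=u(S)$, $u'(0)=u'(S)$; (N) Neumann: $u'(0)=u'(S)=0$. The problem is nonresonant if for $\sigma=0$ it has only the trivial solution; then for every $\sigma\in L^1(0,S)$ it has a unique solution, given by $u(t)=\int_0^S G_B[q,S](t,s)\sigma(s)\,ds$ with $B\in\{P,N\}$, where $G_B[q,S]$ is the (unique, continuous on $[0,S]\times[0,S]$) Green's function. *)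

theory Defs
  imports "HOL-Analysis.Analysis"
begin

(* The epsilon-delta definition. A division is a finite family of nonoverlapping
   nonempty compact intervals; t is their union, which need not be all of [c,d]. *)
definition abs_continuous_on :: "real \<Rightarrow> real \<Rightarrow> (real \<Rightarrow> real) \<Rightarrow> bool" where
  "abs_continuous_on c d f \<longleftrightarrow>
     (\<forall>\<epsilon>>0. \<exists>\<delta>>0. \<forall>D t. D division_of t \<longrightarrow> t \<subseteq> {c..d} \<longrightarrow>
        (\<Sum>K\<in>D. Sup K - Inf K) < \<delta> \<longrightarrow> (\<Sum>K\<in>D. \<bar>f (Sup K) - f (Inf K)\<bar>) < \<epsilon>)"

(* One-sided at the end points, so it depends only on the values of u on [c,d]. *)
definition deriv_on :: "real \<Rightarrow> real \<Rightarrow> (real \<Rightarrow> real) \<Rightarrow> real \<Rightarrow> real" where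
  "deriv_on c d u t = vector_derivative u (at t within {c..d})"

definition W21 :: "real \<Rightarrow> real \<Rightarrow> (real \<Rightarrow> real) set" where
  "W21 c d = {u. u differentiable_on {c..d} \<and> continuous_on {c..d} (deriv_on c d u) \<and>
                 abs_continuous_on c d (deriv_on c d u)}"

datatype bdry = Periodic | Neumann

fun bdry_cond :: "bdry \<Rightarrow> real \<Rightarrow> (real \<Rightarrow> real) \<Rightarrow> bool" where
  "bdry_cond Periodic S u \<longleftrightarrow> u 0 = u S \<and> deriv_on 0 S u 0 = deriv_on 0 S u S"
| "bdry_cond Neumann S u \<longleftrightarrow> deriv_on 0 S u 0 = 0 \<and> deriv_on 0 S u S = 0"

(* The a.e. condition says that u''(t) exists and u''(t) + q(t) u(t) = \<sigma>(t). *)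
definition bvp_solution ::
    "bdry \<Rightarrow> (real \<Rightarrow> real) \<Rightarrow> real \<Rightarrow> (real \<Rightarrow> real) \<Rightarrow> (real \<Rightarrow> real) \<Rightarrow> bool" where
  "bvp_solution B q S \<sigma> u \<longleftrightarrow>
     u \<in> W21 0 S \<and>
     (AE t in lebesgue_on {0..S}. \<exists>u2. (deriv_on 0 S u has_real_derivative u2) (at t within {0..S}) \<and>
        u2 + q t * u t = \<sigma> t) \<and>
     bdry_cond B S u"

definition nonresonant :: "bdry \<Rightarrow> (real \<Rightarrow> real) \<Rightarrow> real \<Rightarrow> bool" where
  "nonresonant B q S \<longleftrightarrow>
     (\<forall>u. bvp_solution B q S (\<lambda>_. 0) u \<longrightarrow> (\<forall>t\<in>{0..S}. u t = 0))"

(* For every integrable \<sigma> the integral is a solution, and it is the only one on [0,S]. *)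
definition is_green :: "bdry \<Rightarrow> (real \<Rightarrow> real) \<Rightarrow> real \<Rightarrow> (real \<Rightarrow> real \<Rightarrow> real) \<Rightarrow> bool" where
  "is_green B q S G \<longleftrightarrow>
     continuous_on ({0..S} \<times> {0..S}) (\<lambda>(t, s). G t s) \<and>
     (\<forall>\<sigma>. \<sigma> absolutely_integrable_on {0..S} \<longrightarrow>
        (\<forall>u. bvp_solution B q S \<sigma> u \<longleftrightarrow>
             (\<forall>t\<in>{0..S}. u t = (LINT s:{0..S}|lebesgue. G t s * \<sigma> s))))"

(* The value 0 off the square only serves to make a total function unique. *)
definition green :: "bdry \<Rightarrow> (real \<Rightarrow> real) \<Rightarrow> real \<Rightarrow> real \<Rightarrow> real \<Rightarrow> real" where
  "green B q S = (THE G. is_green B q S G \<and> (\<forall>t s. (t, s) \<notin> {0..S} \<times> {0..S} \<longrightarrow> G t s = 0))"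

(* The even extension from [0,L] to [0,2L]. *)
definition even_ext :: "real \<Rightarrow> (real \<Rightarrow> real) \<Rightarrow> real \<Rightarrow> real" where
  "even_ext L a t = (if t \<le> L then a t else a (2 * L - t))"

end

theory Submission
  imports Defs
begin

text \<open>
  A Green's function is determined by its action: if two continuous kernels produce the same integral
  against every integrable right-hand side, they agree (\<open>kernel_eqI\<close>, tested on their difference). So
  each identity is an identity between solutions. For \<open>\<sigma>\<close> on \<open>[0,T]\<close> take its even extension
  to \<open>[0,2T]\<close> and let \<open>u\<close> be the solution of the problem on \<open>[0,2T]\<close>, periodic or Neumann. As the extended potential is even too, equation and boundary
  conditions are invariant under \<open>t \<mapsto> 2T - t\<close>, hence by uniqueness \<open>u\<close> is even about \<open>T\<close> and \<open>u'\<close> is odd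
  about \<open>T\<close>. This makes \<open>u'(T) = 0\<close>, and \<open>u'(0) = -u'(2T)\<close> turns the periodic
  condition into \<open>u'(0) = 0\<close>; so \<open>u\<close> restricted to \<open>[0,T]\<close> solves the Neumann problem
  there. Folding the integral over \<open>[0,2T]\<close> onto \<open>[0,T]\<close> gives the first identity, for both boundary conditions
  at once (\<open>is_green_fold\<close>). The reflection symmetry itself is the second identity (\<open>is_green_reflect\<close>), and
  substituting it in the first gives the third and the fourth (\<open>green_fold\<close>).

  The last identity is the third on \<open>[0,2T]\<close> substituted in the fourth. This passes through the Neumann problem on
  \<open>[0,2T]\<close>, whose nonresonance has to be derived: the even extension of a Neumann
  solution is a periodic solution on the doubled interval (\<open>nonresonant_Neumann_of_Periodic\<close>).

  Since \<open>green\<close> is a definite description, all this depends on the existence of a continuous Green's function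
  for every nonresonant problem with integrable potential (\<open>green_exists\<close>). It is built by
  variation of parameters from two solutions of initial value problems; these come from a contraction
  in a weighted supremum norm (\<open>ivp_exists\<close>).

  The equation holds only almost everywhere, so the work is done with its integrated
  form: \<open>u\<close> and \<open>u'\<close> are indefinite integrals (\<open>ode\<close>). In that form
  restricting, reflecting and gluing are plain manipulations of integrals. The equivalence
  with the original notion (\<open>bvp_solution_iff_ode\<close>) rests on three facts of Lebesgue theory proved first:
  an indefinite integral is differentiable almost everywhere with the expected derivative, it is
  absolutely continuous, and an absolutely continuous function is recovered from its almost everywhere derivative.
\<close>

section \<open>Indefinite integrals and absolute continuity\<close>

text \<open>A bad point \<open>t\<close> is an end point of arbitrarily short intervals with a large error in the
  Riemann sum. By Henstock's lemma the errors over disjoint fine intervals have a small sum, so such intervals have small total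
  length; a Vitali family of them, enlarged five times, still covers all bad points.\<close>

lemma Henstock_bad_points_negligible:
  fixes f :: "real \<Rightarrow> real"
  assumes f: "f integrable_on {a..b}" and "e > 0"
  defines "F \<equiv> \<lambda>x. integral {a..x} f"
  shows "negligible {t\<in>{a..b}. \<forall>d>0. \<exists>y\<in>{a..b}. y \<noteq> t \<and> \<bar>y - t\<bar> < d \<and>
           \<bar>F y - F t - f t * (y - t)\<bar> > e * \<bar>y - t\<bar>}" (is "negligible ?E")
  unfolding negligible_outer_le
proof (intro allI impI)
  fix \<eta> :: real assume "\<eta> > 0"
  \<comment> \<open>The enlarged balls have five times the total length, and a bad interval has error at least \<open>e\<close> times its length.\<close>
  then have "e * \<eta> / 5 > 0" using \<open>e > 0\<close> by simp
  then obtain \<gamma> where \<gamma>: "gauge \<gamma>"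
    and hen: "\<And>p. \<lbrakk>p tagged_partial_division_of {a..b}; \<gamma> fine p\<rbrakk> \<Longrightarrow>
             (\<Sum>(x,k)\<in>p. norm (measure lborel k *\<^sub>R f x - integral k f)) < e * \<eta> / 5"
    using Henstock_lemma[of f a b "e * \<eta> / 5", unfolded box_real, OF f] by blast
  define I where "I = (\<lambda>z::real\<times>real. {min (fst z) (snd z)..max (fst z) (snd z)})"
  define m where "m = (\<lambda>z::real\<times>real. (fst z + snd z) / 2)"
  define r where "r = (\<lambda>z::real\<times>real. \<bar>snd z - fst z\<bar> / 2)"
  define K where "K = {z. fst z \<in> {a..b} \<and> snd z \<in> {a..b} \<and> snd z \<noteq> fst z \<and> I z \<subseteq> \<gamma> (fst z) \<and>
      \<bar>F (snd z) - F (fst z) - f (fst z) * (snd z - fst z)\<bar> > e * \<bar>snd z - fst z\<bar>}"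
  have cball: "cball (m z) (r z) = I z" for z
    unfolding cball_eq_atLeastAtMost I_def m_def r_def
    by (auto simp: field_simps min_def max_def abs_if)
  have "\<And>z. z \<in> K \<Longrightarrow> 0 < r z \<and> r z \<le> \<bar>b - a\<bar>"
    by (auto simp: K_def r_def)
  then obtain C where C: "countable C" "C \<subseteq> K"
     and disj: "pairwise (\<lambda>i j. disjnt (cball (m i) (r i)) (cball (m j) (r j))) C"
     and cov: "\<And>i. i \<in> K \<Longrightarrow> \<exists>j. j \<in> C \<and>
                        \<not> disjnt (cball (m i) (r i)) (cball (m j) (r j)) \<and>
                        cball (m i) (r i) \<subseteq> ball (m j) (5 * r j)"
    using Vitali_covering_lemma_cballs_balls[of K r "\<bar>b - a\<bar>" m] by blast
  have sub: "?E \<subseteq> (\<Union>j\<in>C. ball (m j) (5 * r j))"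
  proof
    fix t assume t: "t \<in> ?E"
    obtain d where d: "d > 0" "ball t d \<subseteq> \<gamma> t"
      using \<gamma> by (meson gaugeD open_contains_ball)
    then obtain y where y: "y\<in>{a..b}" "y \<noteq> t" "\<bar>y - t\<bar> < d" "\<bar>F y - F t - f t * (y - t)\<bar> > e * \<bar>y - t\<bar>"
      using t by auto
    have "I (t,y) \<subseteq> ball t d" using y by (auto simp: I_def dist_real_def)
    then have "(t,y) \<in> K" using y t d by (auto simp: K_def)
    then obtain j where "j \<in> C" "I (t,y) \<subseteq> ball (m j) (5 * r j)" using cov cball by metis
    moreover have "t \<in> I (t,y)" by (auto simp: I_def)
    ultimately show "t \<in> (\<Union>j\<in>C. ball (m j) (5 * r j))" by blast
  qed
  have fin: "measure lebesgue (\<Union>j\<in>C'. ball (m j) (5 * r j)) \<le> \<eta>" if C': "C' \<subseteq> C" "finite C'" for C'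
  proof -
    define p where "p = (\<lambda>z. (fst z, I z)) ` C'"
    have dj: "I i \<inter> I j = {}" if "i \<in> C'" "j \<in> C'" "i \<noteq> j" for i j
      using disj that C' unfolding pairwise_def disjnt_def cball by blast
    have ne: "fst i \<in> I i" for i by (auto simp: I_def)
    have inj: "inj_on (\<lambda>z. (fst z, I z)) C'"
      using dj ne by (fastforce intro!: inj_onI)
    have "p tagged_partial_division_of {a..b}"
      unfolding tagged_partial_division_of_def
    proof (intro conjI allI impI)
      show "finite p" using C' by (simp add: p_def)
    next
      fix x k assume "(x,k) \<in> p"
      then obtain z where z: "z \<in> C'" "x = fst z" "k = I z" by (auto simp: p_def)
      then have "z \<in> K" using C C' by auto
      then show "x \<in> k" "k \<subseteq> {a..b}" "\<exists>a b. k = cbox a b"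
        using z ne by (auto simp: K_def I_def)
    next
      fix x1 K1 x2 K2 assume "(x1, K1) \<in> p \<and> (x2, K2) \<in> p \<and> (x1, K1) \<noteq> (x2, K2)"
      then obtain z1 z2 where "z1 \<in> C'" "z2 \<in> C'" "z1 \<noteq> z2" "K1 = I z1" "K2 = I z2"
        unfolding p_def by blast
      then have "K1 \<inter> K2 = {}" using dj by simp
      then show "interior K1 \<inter> interior K2 = {}"
        using interior_subset by blast
    qed
    moreover have "\<gamma> fine p" using C C' by (auto simp: fine_def p_def K_def)
    ultimately have H: "(\<Sum>(x,k)\<in>p. norm (measure lborel k *\<^sub>R f x - integral k f)) < e * \<eta> / 5"
      by (rule hen)
    have eq: "norm (measure lborel (I z) *\<^sub>R f (fst z) - integral (I z) f) =
              \<bar>F (snd z) - F (fst z) - f (fst z) * (snd z - fst z)\<bar>" if "z \<in> C'" for z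
    proof -
      have z: "fst z \<in> {a..b}" "snd z \<in> {a..b}" using that C C' by (auto simp: K_def)
      have comb: "F u + integral {u..v} f = F v" if "a \<le> u" "u \<le> v" "v \<le> b" for u v
        unfolding F_def using that
        by (intro Henstock_Kurzweil_Integration.integral_combine integrable_on_subinterval[OF f]) auto
      show ?thesis
      proof (cases "fst z \<le> snd z")
        case True
        then show ?thesis using comb[of "fst z" "snd z"] z by (auto simp: I_def algebra_simps)
      next
        case False
        then show ?thesis using comb[of "snd z" "fst z"] z by (auto simp: I_def algebra_simps)
      qed
    qed
    have "(\<Sum>(x,k)\<in>p. norm (measure lborel k *\<^sub>R f x - integral k f)) =
          (\<Sum>z\<in>C'. norm (measure lborel (I z) *\<^sub>R f (fst z) - integral (I z) f))"
      unfolding p_def by (subst sum.reindex[OF inj]) (simp add: o_def)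
    also have "\<dots> = (\<Sum>z\<in>C'. \<bar>F (snd z) - F (fst z) - f (fst z) * (snd z - fst z)\<bar>)"
      using eq by (rule sum.cong[OF refl])
    also have "\<dots> \<ge> (\<Sum>z\<in>C'. e * (2 * r z))"
      using C C' by (intro sum_mono) (auto simp: K_def r_def intro: less_imp_le)
    finally have "e * (\<Sum>z\<in>C'. 2 * r z) < e * \<eta> / 5" using H by (simp add: sum_distrib_left)
    then have s: "5 * (\<Sum>z\<in>C'. 2 * r z) < \<eta>" using \<open>e > 0\<close> by (simp add: field_simps)
    have "measure lebesgue (\<Union>j\<in>C'. ball (m j) (5 * r j)) \<le> (\<Sum>j\<in>C'. measure lebesgue (ball (m j) (5 * r j)))"
      using C' by (intro measure_UNION_le) auto
    also have "\<dots> = (\<Sum>j\<in>C'. 10 * r j)"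
    proof (intro sum.cong refl)
      fix j
      have "r j \<ge> 0" by (simp add: r_def)
      then show "measure lebesgue (ball (m j) (5 * r j)) = 10 * r j"
        by (simp add: ball_eq_greaterThanLessThan)
    qed
    also have "\<dots> \<le> \<eta>" using s by (simp add: sum_distrib_left)
    finally show ?thesis .
  qed
  show "\<exists>T. ?E \<subseteq> T \<and> T \<in> lmeasurable \<and> measure lebesgue T \<le> \<eta>"
  proof (intro exI conjI)
    show "(\<Union>j\<in>C. ball (m j) (5 * r j)) \<in> lmeasurable"
      by (rule fmeasurable_UN_bound[OF C(1) _ fin]) auto
    show "measure lebesgue (\<Union>j\<in>C. ball (m j) (5 * r j)) \<le> \<eta>"
      by (rule measure_UN_bound[OF C(1) _ fin]) auto
  qed (rule sub)
qed

text \<open>The derivative fails at \<open>t\<close> exactly if \<open>t\<close> is bad for some tolerance \<open>1 / n\<close>.\<close>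

theorem indefinite_integral_has_derivative_ae:
  fixes f :: "real \<Rightarrow> real"
  assumes f: "f integrable_on {a..b}"
  shows "negligible {t\<in>{a..b}. \<not> ((\<lambda>x. integral {a..x} f) has_real_derivative f t) (at t within {a..b})}"
proof -
  define F where "F = (\<lambda>x. integral {a..x} f)"
  define E where "E = (\<lambda>e. {t\<in>{a..b}. \<forall>d>0. \<exists>y\<in>{a..b}. y \<noteq> t \<and> \<bar>y - t\<bar> < d \<and>
           \<bar>F y - F t - f t * (y - t)\<bar> > e * \<bar>y - t\<bar>})"
  have "negligible (\<Union>n. E (inverse (real (Suc n))))"
    unfolding E_def F_def by (intro negligible_Union_nat Henstock_bad_points_negligible[OF f]) auto
  moreover have "{t\<in>{a..b}. \<not> (F has_real_derivative f t) (at t within {a..b})} \<subseteq> (\<Union>n. E (inverse (real (Suc n))))"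
  proof
    fix t assume t: "t \<in> {t\<in>{a..b}. \<not> (F has_real_derivative f t) (at t within {a..b})}"
    then obtain e where e: "e > 0" and
      bad: "\<And>d. d > 0 \<Longrightarrow> \<exists>y\<in>{a..b}. norm (y - t) < d \<and> norm (F y - F t - f t * (y - t)) > e * norm (y - t)"
      unfolding has_field_derivative_def has_derivative_within_alt
      by (force simp: not_le bounded_linear_mult_right)
    obtain n where n: "inverse (real (Suc n)) < e" using reals_Archimedean[OF e] by blast
    have "t \<in> E (inverse (real (Suc n)))"
      unfolding E_def
    proof (intro CollectI conjI allI impI)
      fix d :: real assume "d > 0"
      then obtain y where y: "y\<in>{a..b}" "\<bar>y - t\<bar> < d" "\<bar>F y - F t - f t * (y - t)\<bar> > e * \<bar>y - t\<bar>"
        using bad[of d] by auto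
      have "inverse (real (Suc n)) * \<bar>y - t\<bar> \<le> e * \<bar>y - t\<bar>" using n by (intro mult_right_mono) auto
      then show "\<exists>y\<in>{a..b}. y \<noteq> t \<and> \<bar>y - t\<bar> < d \<and> \<bar>F y - F t - f t * (y - t)\<bar> > inverse (real (Suc n)) * \<bar>y - t\<bar>"
        using y by (intro bexI[of _ y]) auto
    qed (use t in auto)
    then show "t \<in> (\<Union>n. E (inverse (real (Suc n))))" by blast
  qed
  ultimately show ?thesis
    unfolding F_def using negligible_subset by blast
qed

text \<open>The gauge is chosen in two ways. At a point of differentiability it makes the error of the Riemann sum proportional to the
  length of the interval. At an exceptional point it forces the interval into an open set
  of small measure, where absolute continuity bounds the increments of \<open>F\<close>; the integrand is
  replaced by 0 there, so that its values do not matter.\<close>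

theorem AC_fundamental_theorem:
  assumes ab: "a \<le> b" and ac: "abs_continuous_on a b F" and N: "negligible N"
    and der: "\<And>t. t \<in> {a..b} - N \<Longrightarrow> (F has_real_derivative f t) (at t within {a..b})"
  shows "(f has_integral (F b - F a)) {a..b}"
proof -
  define g where "g = (\<lambda>t. if t \<in> N then 0 else f t)"
  have "(g has_integral (F b - F a)) {a..b}"
    unfolding has_integral_real
  proof (intro allI impI)
    fix e :: real assume e: "e > 0"
    \<comment> \<open>The added 1 covers \<open>a = b\<close> and makes the bound on \<open>c * (b - a)\<close> strict.\<close>
    define c where "c = e / 2 / (b - a + 1)"
    have c: "c > 0" "c * (b - a) < e / 2" using e ab by (auto simp: c_def field_simps)
    obtain \<delta> where \<delta>: "\<delta> > 0" and AC: "\<And>D t. \<lbrakk>D division_of t; t \<subseteq> {a..b};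
        (\<Sum>K\<in>D. Sup K - Inf K) < \<delta>\<rbrakk> \<Longrightarrow> (\<Sum>K\<in>D. \<bar>F (Sup K) - F (Inf K)\<bar>) < e / 2"
      using ac[unfolded abs_continuous_on_def, rule_format, of "e/2"] e by auto
    obtain U where U: "open U" "N \<subseteq> U" "(U - N) \<in> lmeasurable" "emeasure lebesgue (U - N) < ennreal \<delta>"
      using sets_lebesgue_outer_open[OF negligible_imp_sets[OF N] \<delta>] by blast
    have "\<forall>t. \<exists>d>0. t \<in> {a..b} - N \<longrightarrow> (\<forall>y\<in>{a..b}. \<bar>y - t\<bar> < d \<longrightarrow> \<bar>F y - F t - f t * (y - t)\<bar> \<le> c * \<bar>y - t\<bar>)"
    proof
      fix t show "\<exists>d>0. t \<in> {a..b} - N \<longrightarrow> (\<forall>y\<in>{a..b}. \<bar>y - t\<bar> < d \<longrightarrow> \<bar>F y - F t - f t * (y - t)\<bar> \<le> c * \<bar>y - t\<bar>)"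
      proof (cases "t \<in> {a..b} - N")
        case True
        then show ?thesis
          using der[OF True] c(1) unfolding has_field_derivative_def has_derivative_within_alt
          by (metis real_norm_def)
      qed (use zero_less_one in blast)
    qed
    then obtain d where d: "\<And>t. d t > 0"
      "\<And>t y. \<lbrakk>t \<in> {a..b} - N; y\<in>{a..b}; \<bar>y - t\<bar> < d t\<rbrakk> \<Longrightarrow> \<bar>F y - F t - f t * (y - t)\<bar> \<le> c * \<bar>y - t\<bar>"
      by metis
    define \<gamma> where "\<gamma> = (\<lambda>t. if t \<in> N then U else ball t (d t))"
    have "gauge \<gamma>" using U d(1) by (auto simp: \<gamma>_def gauge_def)
    moreover have "norm ((\<Sum>(x, k)\<in>p. measure lborel k *\<^sub>R g x) - (F b - F a)) < e"
      if p: "p tagged_division_of {a..b}" and fine: "\<gamma> fine p" for p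
    proof -
      note pD = tagged_division_ofD[OF p]
      define err where "err = (\<lambda>(x::real, k::real set). measure lborel k * g x - (F (Sup k) - F (Inf k)))"
      have K: "\<exists>u v. k = {u..v} \<and> u \<le> x \<and> x \<le> v \<and> a \<le> u \<and> v \<le> b" if xk: "(x,k) \<in> p" for x k
      proof -
        obtain u v where "k = {u..v}" using pD(4)[OF xk] by auto
        then show ?thesis using pD(2,3)[OF xk] by auto
      qed
      have fp: "finite p" by (rule pD(1))
      have split: "(\<Sum>z\<in>p. \<bar>err z\<bar>) = (\<Sum>z\<in>{z\<in>p. fst z \<notin> N}. \<bar>err z\<bar>) + (\<Sum>z\<in>{z\<in>p. fst z \<in> N}. \<bar>err z\<bar>)"
        using fp by (subst sum.union_disjoint[symmetric]) (auto intro!: sum.cong)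
      have "(\<Sum>z\<in>{z\<in>p. fst z \<notin> N}. \<bar>err z\<bar>) \<le> (\<Sum>z\<in>{z\<in>p. fst z \<notin> N}. c * measure lborel (snd z))"
      proof (intro sum_mono)
        fix z assume "z \<in> {z\<in>p. fst z \<notin> N}"
        then obtain x k where z: "z = (x,k)" "(x,k) \<in> p" "x \<notin> N" by (cases z) auto
        obtain u v where k: "k = {u..v}" "u \<le> x" "x \<le> v" "a \<le> u" "v \<le> b" using K[OF z(2)] by blast
        have "k \<subseteq> \<gamma> x" using fine z(2) by (auto simp: fine_def)
        then have "{u..v} \<subseteq> ball x (d x)" using z(3) k(1) by (simp add: \<gamma>_def)
        moreover have "u \<in> {u..v}" "v \<in> {u..v}" using k by auto
        ultimately have "\<bar>u - x\<bar> < d x" "\<bar>v - x\<bar> < d x"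
          by (metis dist_commute dist_real_def mem_ball subsetD)+
        then have "\<bar>F u - F x - f x * (u - x)\<bar> \<le> c * \<bar>u - x\<bar>" "\<bar>F v - F x - f x * (v - x)\<bar> \<le> c * \<bar>v - x\<bar>"
          using d(2)[of x u] d(2)[of x v] z k by auto
        moreover have "c * \<bar>u - x\<bar> + c * \<bar>v - x\<bar> = c * (v - u)" using k by (simp add: algebra_simps)
        moreover have "(v - u) * f x - (F v - F u) = (F u - F x - f x * (u - x)) - (F v - F x - f x * (v - x))"
          by (simp add: algebra_simps)
        ultimately have "\<bar>(v - u) * f x - (F v - F u)\<bar> \<le> c * (v - u)" by linarith
        then show "\<bar>err z\<bar> \<le> c * measure lborel (snd z)" using z k by (simp add: err_def g_def)
      qed
      also have "\<dots> \<le> (\<Sum>z\<in>p. c * measure lborel (snd z))"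
        using fp c(1) by (intro sum_mono2) auto
      also have "\<dots> = c * (b - a)"
      proof -
        have "(\<Sum>z\<in>p. measure lborel (snd z)) = b - a"
          using additive_content_tagged_division[of p a b] p ab by (simp add: case_prod_unfold)
        then show ?thesis by (simp add: sum_distrib_left[symmetric])
      qed
      also have "\<dots> < e / 2" by (rule c)
      finally have s1: "(\<Sum>z\<in>{z\<in>p. fst z \<notin> N}. \<bar>err z\<bar>) < e / 2" .
      define q where "q = {z\<in>p. fst z \<in> N}"
      have qp: "q tagged_partial_division_of {a..b}"
        using p tagged_partial_division_subset[of p "{a..b}" q] by (auto simp: q_def tagged_division_of_def)
      then have qd: "q tagged_division_of \<Union>(snd ` q)"
        using tagged_partial_division_of_Union_self[OF qp] by (simp add: image_def)
      have red: "(\<Sum>z\<in>q. h (snd z)) = (\<Sum>k\<in>snd ` q. h k)" if "\<And>u v. box u v = {} \<Longrightarrow> h (cbox u v) = 0"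
        for h :: "real set \<Rightarrow> real"
        using sum.over_tagged_division_lemma[OF qd, of h] that by (simp add: case_prod_unfold)
      have kq: "\<exists>u v. k = {u..v} \<and> u \<le> v \<and> k \<subseteq> {a..b} \<and> k \<subseteq> U" if kk: "k \<in> snd ` q" for k
      proof -
        obtain x where x: "(x,k) \<in> p" "x \<in> N" using kk by (auto simp: q_def)
        have "k \<subseteq> \<gamma> x" using fine x(1) by (auto simp: fine_def)
        then have "k \<subseteq> U" using x(2) by (simp add: \<gamma>_def)
        moreover obtain u v where "k = {u..v}" "u \<le> x" "x \<le> v" "a \<le> u" "v \<le> b" using K[OF x(1)] by blast
        ultimately show ?thesis by (intro exI[of _ u] exI[of _ v]) auto
      qed
      have div: "(snd ` q) division_of \<Union>(snd ` q)" by (rule division_of_tagged_division[OF qd])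
      have "(\<Sum>k\<in>snd ` q. Sup k - Inf k) = (\<Sum>k\<in>snd ` q. measure lebesgue k)"
      proof (rule sum.cong[OF refl])
        fix k assume kin: "k \<in> snd ` q"
        obtain u v where "k = {u..v}" "u \<le> v" using kq[OF kin] by blast
        then show "Sup k - Inf k = measure lebesgue k" by simp
      qed
      also have "\<dots> = measure lebesgue (\<Union>(snd ` q))" by (rule content_division[OF div])
      also have "\<dots> = measure lebesgue (\<Union>(snd ` q) - N)"
      proof -
        have "negligible ((\<Union>(snd ` q) - (\<Union>(snd ` q) - N)) \<union> ((\<Union>(snd ` q) - N) - \<Union>(snd ` q)))"
          by (rule negligible_subset[OF N]) blast
        from measure_negligible_symdiff[OF lmeasurable_division[OF div] this] show ?thesis by simp
      qed
      also have "\<dots> \<le> measure lebesgue (U - N)"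
      proof (rule measure_mono_fmeasurable)
        show "\<Union>(snd ` q) - N \<subseteq> U - N" using kq by blast
        show "\<Union>(snd ` q) - N \<in> sets lebesgue"
          by (rule sets.Diff[OF fmeasurableD[OF lmeasurable_division[OF div]] negligible_imp_sets[OF N]])
      qed (rule U(3))
      also have "\<dots> < \<delta>"
      proof -
        have "ennreal (measure lebesgue (U - N)) < ennreal \<delta>"
          using U(4) emeasure_eq_measure2[OF U(3)] by simp
        then show ?thesis by (simp add: ennreal_less_iff)
      qed
      finally have "(\<Sum>k\<in>snd ` q. \<bar>F (Sup k) - F (Inf k)\<bar>) < e / 2"
        using kq by (intro AC[OF div]) blast+
      moreover have "(\<Sum>z\<in>q. \<bar>err z\<bar>) = (\<Sum>z\<in>q. \<bar>F (Sup (snd z)) - F (Inf (snd z))\<bar>)"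
        by (intro sum.cong refl) (auto simp: err_def g_def q_def)
      moreover have "(\<Sum>z\<in>q. \<bar>F (Sup (snd z)) - F (Inf (snd z))\<bar>) = (\<Sum>k\<in>snd ` q. \<bar>F (Sup k) - F (Inf k)\<bar>)"
      proof -
        define h where "h = (\<lambda>k. if k = {} then 0 else \<bar>F (Sup k) - F (Inf k)\<bar>)"
        have ne: "h k = \<bar>F (Sup k) - F (Inf k)\<bar>" if kin: "k \<in> snd ` q" for k
        proof -
          obtain u v where "k = {u..v}" "u \<le> v" using kq[OF kin] by blast
          then have "k \<noteq> {}" by simp
          then show ?thesis unfolding h_def by (rule if_not_P)
        qed
        have "(\<Sum>z\<in>q. h (snd z)) = (\<Sum>k\<in>snd ` q. h k)"
        proof (rule red)
          fix u v :: real assume "box u v = {}"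
          then have "v \<le> u" by simp
          then consider "v < u" | "u = v" by linarith
          then show "h (cbox u v) = 0" by cases (simp_all add: h_def)
        qed
        also have "(\<Sum>z\<in>q. h (snd z)) = (\<Sum>z\<in>q. \<bar>F (Sup (snd z)) - F (Inf (snd z))\<bar>)"
          by (rule sum.cong[OF refl], rule ne) simp
        also have "(\<Sum>k\<in>snd ` q. h k) = (\<Sum>k\<in>snd ` q. \<bar>F (Sup k) - F (Inf k)\<bar>)"
          by (rule sum.cong[OF refl], rule ne)
        finally show ?thesis .
      qed
      ultimately have s2: "(\<Sum>z\<in>q. \<bar>err z\<bar>) < e / 2" by simp
      have "(\<Sum>(x, k)\<in>p. measure lborel k *\<^sub>R g x) - (F b - F a) = (\<Sum>z\<in>p. err z)"
        using additive_tagged_division_1[OF ab p, of F] by (simp add: err_def case_prod_unfold sum_subtractf)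
      then have "norm ((\<Sum>(x, k)\<in>p. measure lborel k *\<^sub>R g x) - (F b - F a)) \<le> (\<Sum>z\<in>p. \<bar>err z\<bar>)"
        using sum_abs by simp
      then show ?thesis using split s1 s2 unfolding q_def by linarith
    qed
    ultimately show "\<exists>\<gamma>. gauge \<gamma> \<and> (\<forall>\<D>. \<D> tagged_division_of {a..b} \<and> \<gamma> fine \<D> \<longrightarrow>
        norm ((\<Sum>(x, k)\<in>\<D>. measure lborel k *\<^sub>R g x) - (F b - F a)) < e)"
      by (intro exI[of _ \<gamma>] conjI allI impI) simp_all
  qed
  then show ?thesis
    by (rule has_integral_spike[OF N, rotated]) (auto simp: g_def)
qed

text \<open>Truncation: \<open>min \<bar>f\<bar> n\<close> contributes at most \<open>n\<close> times the total length of the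
  intervals, and the integral of the remainder \<open>\<bar>f\<bar> - min \<bar>f\<bar> n\<close> tends to 0 by dominated convergence.\<close>

theorem indefinite_integral_AC:
  fixes f :: "real \<Rightarrow> real"
  assumes f: "f absolutely_integrable_on {a..b}"
  shows "abs_continuous_on a b (\<lambda>x. integral {a..x} f)"
  unfolding abs_continuous_on_def
proof (intro allI impI)
  fix e :: real assume e: "e > 0"
  have fa: "(\<lambda>x. \<bar>f x\<bar>) absolutely_integrable_on {a..b}"
    using f absolutely_integrable_norm[OF f] by (simp add: o_def)
  have gn: "(\<lambda>x. min \<bar>f x\<bar> (real n)) absolutely_integrable_on {a..b}" for n
    by (intro absolutely_integrable_min_1 fa absolutely_integrable_on_const) auto
  have "(\<lambda>n. integral {a..b} (\<lambda>x. min \<bar>f x\<bar> (real n))) \<longlonglongrightarrow> integral {a..b} (\<lambda>x. \<bar>f x\<bar>)"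
  proof (rule dominated_convergence(2)[where h = "\<lambda>x. \<bar>f x\<bar>"])
    fix x
    obtain k where "\<bar>f x\<bar> \<le> real k" using real_arch_simple by blast
    then have "eventually (\<lambda>n. \<bar>f x\<bar> = min \<bar>f x\<bar> (real n)) sequentially"
      by (intro eventually_sequentiallyI[of k]) auto
    then show "(\<lambda>n. min \<bar>f x\<bar> (real n)) \<longlonglongrightarrow> \<bar>f x\<bar>"
      by (rule Lim_transform_eventually[OF tendsto_const])
  qed (use gn fa set_lebesgue_integral_eq_integral(1) in auto)
  then obtain n where n: "\<bar>integral {a..b} (\<lambda>x. min \<bar>f x\<bar> (real n)) - integral {a..b} (\<lambda>x. \<bar>f x\<bar>)\<bar> < e / 2"
    using e unfolding LIMSEQ_iff by (metis half_gt_zero order_refl real_norm_def)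
  define \<delta> where "\<delta> = e / 2 / (real n + 1)"
  have \<delta>: "\<delta> > 0" "real n * \<delta> < e / 2" using e by (auto simp: \<delta>_def field_simps)
  show "\<exists>\<delta>>0. \<forall>D t. D division_of t \<longrightarrow> t \<subseteq> {a..b} \<longrightarrow> (\<Sum>K\<in>D. Sup K - Inf K) < \<delta> \<longrightarrow>
     (\<Sum>K\<in>D. \<bar>integral {a..Sup K} f - integral {a..Inf K} f\<bar>) < e"
  proof (intro exI conjI allI impI)
    fix D t assume D: "D division_of t" and t: "t \<subseteq> {a..b}" and small: "(\<Sum>K\<in>D. Sup K - Inf K) < \<delta>"
    define h where "h = (\<lambda>x. \<bar>f x\<bar> - min \<bar>f x\<bar> (real n))"
    have h: "h integrable_on {a..b}" unfolding h_def
      using gn fa by (intro integrable_diff set_lebesgue_integral_eq_integral(1)) auto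
    have K: "\<exists>u v. K = {u..v} \<and> u \<le> v \<and> a \<le> u \<and> v \<le> b" if "K \<in> D" for K
      using division_ofD(2,3,4)[OF D that] t by fastforce
    have "(\<Sum>K\<in>D. \<bar>integral {a..Sup K} f - integral {a..Inf K} f\<bar>) \<le> (\<Sum>K\<in>D. real n * (Sup K - Inf K) + integral K h)"
    proof (intro sum_mono)
      fix K assume "K \<in> D"
      then obtain u v where k: "K = {u..v}" "u \<le> v" "a \<le> u" "v \<le> b" using K by blast
      then have s: "{u..v} \<subseteq> {a..b}" by auto
      have fi: "f integrable_on {a..b}" using f set_lebesgue_integral_eq_integral(1) by blast
      have "integral {a..u} f + integral {u..v} f = integral {a..v} f"
        using k by (intro Henstock_Kurzweil_Integration.integral_combine integrable_on_subinterval[OF fi]) auto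
      then have "\<bar>integral {a..Sup K} f - integral {a..Inf K} f\<bar> = norm (integral {u..v} f)" using k by auto
      also have "\<dots> \<le> integral {u..v} (\<lambda>x. real n + h x)"
        by (intro integral_norm_bound_integral integrable_on_subinterval[OF fi s] integrable_add
              integrable_on_subinterval[OF h s]) (auto simp: h_def)
      also have "\<dots> = real n * (Sup K - Inf K) + integral K h"
        using k by (subst integral_add) (auto intro: integrable_on_subinterval[OF h s])
      finally show "\<bar>integral {a..Sup K} f - integral {a..Inf K} f\<bar> \<le> real n * (Sup K - Inf K) + integral K h" .
    qed
    also have "\<dots> = real n * (\<Sum>K\<in>D. Sup K - Inf K) + (\<Sum>K\<in>D. integral K h)"
      by (simp add: sum.distrib sum_distrib_left)
    also have "(\<Sum>K\<in>D. integral K h) = integral t h"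
      using integral_combine_division_topdown[OF _ D, of h] integrable_on_subdivision[OF D h t] by simp
    also have "\<dots> \<le> integral {a..b} h"
      by (rule integral_subset_le[OF t integrable_on_subdivision[OF D h t] h]) (auto simp: h_def)
    also have "\<dots> = integral {a..b} (\<lambda>x. \<bar>f x\<bar>) - integral {a..b} (\<lambda>x. min \<bar>f x\<bar> (real n))"
      unfolding h_def using gn fa by (intro integral_diff set_lebesgue_integral_eq_integral(1)) auto
    also have "\<dots> < e / 2" using n by linarith
    finally have "(\<Sum>K\<in>D. \<bar>integral {a..Sup K} f - integral {a..Inf K} f\<bar>) < real n * (\<Sum>K\<in>D. Sup K - Inf K) + e / 2"
      by simp
    also have "\<dots> \<le> real n * \<delta> + e / 2" using small by (simp add: mult_left_mono)
    also have "\<dots> < e" using \<delta> by simp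
    finally show "(\<Sum>K\<in>D. \<bar>integral {a..Sup K} f - integral {a..Inf K} f\<bar>) < e" .
  qed (rule \<delta>)
qed

lemma has_real_derivative_cong_on:
  assumes "t \<in> A" "\<And>x. x \<in> A \<Longrightarrow> f x = g x" "(f has_real_derivative d) (at t within A)"
  shows "(g has_real_derivative d) (at t within A)"
  using has_field_derivative_transform_within[OF assms(3) zero_less_one assms(1)] assms(2) by blast

text \<open>One \<open>\<delta>\<close> answering one \<open>\<epsilon>\<close>, so that absolute continuity of one function can be transferred to another
  modulus by modulus.\<close>

definition ac_modulus :: "real \<Rightarrow> real \<Rightarrow> (real \<Rightarrow> real) \<Rightarrow> real \<Rightarrow> real \<Rightarrow> bool" where
  "ac_modulus a b F \<epsilon> \<delta> \<longleftrightarrow> (\<forall>D t. D division_of t \<longrightarrow> t \<subseteq> {a..b} \<longrightarrow>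
     (\<Sum>K\<in>D. Sup K - Inf K) < \<delta> \<longrightarrow> (\<Sum>K\<in>D. \<bar>F (Sup K) - F (Inf K)\<bar>) < \<epsilon>)"

lemma ac_modulusD:
  "\<lbrakk>ac_modulus a b F \<epsilon> \<delta>; D division_of t; t \<subseteq> {a..b}; (\<Sum>K\<in>D. Sup K - Inf K) < \<delta>\<rbrakk>
     \<Longrightarrow> (\<Sum>K\<in>D. \<bar>F (Sup K) - F (Inf K)\<bar>) < \<epsilon>"
  by (simp add: ac_modulus_def)

lemma ac_modulusI:
  "(\<And>D t. \<lbrakk>D division_of t; t \<subseteq> {a..b}; (\<Sum>K\<in>D. Sup K - Inf K) < \<delta>\<rbrakk>
     \<Longrightarrow> (\<Sum>K\<in>D. \<bar>F (Sup K) - F (Inf K)\<bar>) < \<epsilon>) \<Longrightarrow> ac_modulus a b F \<epsilon> \<delta>"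
  by (simp add: ac_modulus_def)

lemma abs_continuous_on_modulus:
  "abs_continuous_on a b F \<longleftrightarrow> (\<forall>\<epsilon>>0. \<exists>\<delta>>0. ac_modulus a b F \<epsilon> \<delta>)"
  unfolding abs_continuous_on_def ac_modulus_def ..

lemma abs_continuous_on_subinterval:
  assumes "abs_continuous_on a b F" "{c..d} \<subseteq> {a..b}"
  shows "abs_continuous_on c d F"
proof -
  have "ac_modulus c d F \<epsilon> \<delta>" if "ac_modulus a b F \<epsilon> \<delta>" for \<epsilon> \<delta>
    by (rule ac_modulusI) (rule ac_modulusD[OF that], assumption, erule order_trans, rule assms(2))
  then show ?thesis using assms(1) unfolding abs_continuous_on_modulus by blast
qed

lemma division_interval_endpoints:
  assumes "D division_of t" "t \<subseteq> {a..b::real}" "K \<in> D"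
  shows "Sup K \<in> {a..b}" "Inf K \<in> {a..b}" "Inf K \<le> Sup K"
proof -
  obtain u v where "K = {u..v}" "u \<le> v" "K \<subseteq> {a..b}"
    using division_ofD(2,3,4)[OF assms(1,3)] assms(2) by fastforce
  then show "Sup K \<in> {a..b}" "Inf K \<in> {a..b}" "Inf K \<le> Sup K" by auto
qed

lemma abs_continuous_on_cong:
  assumes "abs_continuous_on a b F" and eq: "\<And>x y. x \<in> {a..b} \<Longrightarrow> y \<in> {a..b} \<Longrightarrow> F x - F y = G x - G y"
  shows "abs_continuous_on a b G"
proof -
  have eq': "(\<Sum>K\<in>D. \<bar>G (Sup K) - G (Inf K)\<bar>) = (\<Sum>K\<in>D. \<bar>F (Sup K) - F (Inf K)\<bar>)"
    if "D division_of t" "t \<subseteq> {a..b}" for D t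
    using division_interval_endpoints[OF that] by (intro sum.cong refl) (simp add: eq)
  have "ac_modulus a b G \<epsilon> \<delta>" if "ac_modulus a b F \<epsilon> \<delta>" for \<epsilon> \<delta>
    using ac_modulusD[OF that] eq' by (intro ac_modulusI) simp
  then show ?thesis using assms(1) unfolding abs_continuous_on_modulus by blast
qed

lemma abs_continuous_on_mult:
  assumes F: "abs_continuous_on a b F" "continuous_on {a..b} F"
    and G: "abs_continuous_on a b G" "continuous_on {a..b} G"
  shows "abs_continuous_on a b (\<lambda>t. F t * G t)"
proof -
  have "\<exists>M. \<forall>t\<in>{a..b}. \<bar>h t\<bar> \<le> M" if "continuous_on {a..b} h" for h :: "real \<Rightarrow> real"
    using compact_imp_bounded[OF compact_continuous_image[OF that]] by (auto simp: bounded_iff)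
  then obtain M1 M2 where M1: "\<forall>t\<in>{a..b}. \<bar>F t\<bar> \<le> M1" and M2: "\<forall>t\<in>{a..b}. \<bar>G t\<bar> \<le> M2"
    using F G by metis
  define M where "M = max 1 (max M1 M2)"
  have M: "M > 0" "\<And>t. t \<in> {a..b} \<Longrightarrow> \<bar>F t\<bar> \<le> M" "\<And>t. t \<in> {a..b} \<Longrightarrow> \<bar>G t\<bar> \<le> M"
    using M1 M2 by (auto simp: M_def le_max_iff_disj)
  show ?thesis
    unfolding abs_continuous_on_modulus
  proof (intro allI impI)
    fix e :: real assume "e > 0"
    then have e: "e / (2 * M) > 0" using M by simp
    obtain d1 where d1: "d1 > 0" "ac_modulus a b F (e / (2 * M)) d1"
      using F(1) e unfolding abs_continuous_on_modulus by blast
    obtain d2 where d2: "d2 > 0" "ac_modulus a b G (e / (2 * M)) d2"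
      using G(1) e unfolding abs_continuous_on_modulus by blast
    have "ac_modulus a b (\<lambda>t. F t * G t) e (min d1 d2)"
    proof (rule ac_modulusI)
      fix D t assume D: "D division_of t" and t: "t \<subseteq> {a..b}" and small: "(\<Sum>K\<in>D. Sup K - Inf K) < min d1 d2"
      have "(\<Sum>K\<in>D. \<bar>F (Sup K) * G (Sup K) - F (Inf K) * G (Inf K)\<bar>)
        \<le> (\<Sum>K\<in>D. M * \<bar>F (Sup K) - F (Inf K)\<bar> + M * \<bar>G (Sup K) - G (Inf K)\<bar>)"
      proof (intro sum_mono)
        fix K assume "K \<in> D"
        note K = division_interval_endpoints[OF D t this]
        have "F (Sup K) * G (Sup K) - F (Inf K) * G (Inf K) =
            G (Sup K) * (F (Sup K) - F (Inf K)) + F (Inf K) * (G (Sup K) - G (Inf K))"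
          by (simp add: algebra_simps)
        also have "\<bar>\<dots>\<bar> \<le> \<bar>G (Sup K)\<bar> * \<bar>F (Sup K) - F (Inf K)\<bar> + \<bar>F (Inf K)\<bar> * \<bar>G (Sup K) - G (Inf K)\<bar>"
          by (metis abs_mult abs_triangle_ineq)
        also have "\<dots> \<le> M * \<bar>F (Sup K) - F (Inf K)\<bar> + M * \<bar>G (Sup K) - G (Inf K)\<bar>"
          using M K by (intro add_mono mult_right_mono) auto
        finally show "\<bar>F (Sup K) * G (Sup K) - F (Inf K) * G (Inf K)\<bar>
          \<le> M * \<bar>F (Sup K) - F (Inf K)\<bar> + M * \<bar>G (Sup K) - G (Inf K)\<bar>" .
      qed
      also have "\<dots> = M * ((\<Sum>K\<in>D. \<bar>F (Sup K) - F (Inf K)\<bar>) + (\<Sum>K\<in>D. \<bar>G (Sup K) - G (Inf K)\<bar>))"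
        by (simp add: sum.distrib sum_distrib_left distrib_left)
      also have "\<dots> < M * (e / (2 * M) + e / (2 * M))"
        using ac_modulusD[OF d1(2) D t] ac_modulusD[OF d2(2) D t] small M(1) by (intro mult_strict_left_mono add_strict_mono) auto
      also have "\<dots> = e" using M(1) by simp
      finally show "(\<Sum>K\<in>D. \<bar>F (Sup K) * G (Sup K) - F (Inf K) * G (Inf K)\<bar>) < e" .
    qed
    with d1(1) d2(1) show "\<exists>\<delta>>0. ac_modulus a b (\<lambda>t. F t * G t) e \<delta>"
      by (intro exI[of _ "min d1 d2"]) simp
  qed
qed

section \<open>The boundary value problem in integrated form\<close>

definition primitive :: "real \<Rightarrow> (real \<Rightarrow> real) \<Rightarrow> (real \<Rightarrow> real) \<Rightarrow> bool" where
  "primitive S F f \<longleftrightarrow> f absolutely_integrable_on {0..S} \<and> (\<forall>t\<in>{0..S}. F t = F 0 + integral {0..t} f)"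

lemma continuous_mult_abs_integrable:
  fixes f g :: "real \<Rightarrow> real"
  assumes "continuous_on {a..b} f" "g absolutely_integrable_on {a..b}"
  shows "(\<lambda>t. f t * g t) absolutely_integrable_on {a..b}" "(\<lambda>t. g t * f t) absolutely_integrable_on {a..b}"
proof -
  show *: "(\<lambda>t. f t * g t) absolutely_integrable_on {a..b}"
    using assms compact_imp_bounded[OF compact_continuous_image[OF assms(1)]]
    by (intro absolutely_integrable_bounded_measurable_product_real)
       (auto intro!: continuous_imp_measurable_on_sets_lebesgue)
  then show "(\<lambda>t. g t * f t) absolutely_integrable_on {a..b}"
    by (simp add: mult.commute)
qed

lemma abs_integrable_subinterval_integrable:
  fixes f :: "real \<Rightarrow> real"
  assumes "f absolutely_integrable_on {a..b}" "{c..d} \<subseteq> {a..b}"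
  shows "f integrable_on {c..d}"
  using absolutely_integrable_on_subinterval[OF assms] set_lebesgue_integral_eq_integral(1) by blast

lemma primitiveD:
  assumes "primitive S F f"
  shows "f absolutely_integrable_on {0..S}" "\<And>t. t \<in> {0..S} \<Longrightarrow> F t = F 0 + integral {0..t} f"
    "\<And>t. t \<in> {0..S} \<Longrightarrow> f integrable_on {0..t}"
proof -
  show f: "f absolutely_integrable_on {0..S}" and "\<And>t. t \<in> {0..S} \<Longrightarrow> F t = F 0 + integral {0..t} f"
    using assms unfolding primitive_def by blast+
  show "f integrable_on {0..t}" if "t \<in> {0..S}" for t
    by (rule abs_integrable_subinterval_integrable[OF f]) (use that in simp)
qed

lemma primitive_continuous:
  assumes "primitive S F f"
  shows "continuous_on {0..S} F"
proof -
  have "continuous_on {0..S} (\<lambda>t. F 0 + integral {0..t} f)"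
    using primitiveD(1)[OF assms] set_lebesgue_integral_eq_integral(1)
    by (intro continuous_intros indefinite_integral_continuous_1) blast
  then show ?thesis by (rule continuous_on_eq) (rule primitiveD(2)[OF assms, symmetric])
qed

lemma primitive_abs_continuous:
  assumes "primitive S F f"
  shows "abs_continuous_on 0 S F"
proof (rule abs_continuous_on_cong[OF indefinite_integral_AC[OF primitiveD(1)[OF assms]]])
  fix x y assume "x \<in> {0..S}" "y \<in> {0..S}"
  then show "integral {0..x} f - integral {0..y} f = F x - F y"
    using primitiveD(2)[OF assms, of x] primitiveD(2)[OF assms, of y] by linarith
qed

lemma primitive_derivative_ae:
  assumes "primitive S F f"
  obtains N where "negligible N" "\<And>t. t \<in> {0..S} - N \<Longrightarrow> (F has_real_derivative f t) (at t within {0..S})"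
proof -
  define N where "N = {t\<in>{0..S}. \<not> ((\<lambda>x. integral {0..x} f) has_real_derivative f t) (at t within {0..S})}"
  have "f integrable_on {0..S}" using primitiveD(1)[OF assms] set_lebesgue_integral_eq_integral(1) by blast
  then have neg: "negligible N" unfolding N_def by (rule indefinite_integral_has_derivative_ae)
  have der: "(F has_real_derivative f t) (at t within {0..S})" if t: "t \<in> {0..S} - N" for t
  proof -
    have "((\<lambda>x. F 0 + integral {0..x} f) has_real_derivative 0 + f t) (at t within {0..S})"
      using t by (intro derivative_intros) (auto simp: N_def)
    then have "((\<lambda>x. F 0 + integral {0..x} f) has_real_derivative f t) (at t within {0..S})"
      by simp
    with t show ?thesis
      by (intro has_real_derivative_cong_on[OF _ primitiveD(2)[OF assms, symmetric]]) auto
  qed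
  show ?thesis by (rule that[OF neg]) (rule der)
qed

lemma primitiveI_abs_continuous:
  assumes ac: "abs_continuous_on 0 S F" and f: "f absolutely_integrable_on {0..S}" and N: "negligible N"
    and der: "\<And>t. t \<in> {0..S} - N \<Longrightarrow> (F has_real_derivative f t) (at t within {0..S})"
  shows "primitive S F f"
  unfolding primitive_def
proof (intro conjI ballI f)
  fix t assume t: "t \<in> {0..S}"
  have "(f has_integral (F t - F 0)) {0..t}"
  proof (rule AC_fundamental_theorem[OF _ _ N])
    show "abs_continuous_on 0 t F" by (rule abs_continuous_on_subinterval[OF ac]) (use t in auto)
    show "(F has_real_derivative f x) (at x within {0..t})" if "x \<in> {0..t} - N" for x
      using that t by (intro DERIV_subset[OF der]) auto
  qed (use t in auto)
  then show "F t = F 0 + integral {0..t} f" by (simp add: integral_unique)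
qed

text \<open>Integration by parts; the product rule holds only almost everywhere, which suffices because a
  product of absolutely continuous functions is absolutely continuous.\<close>

lemma primitive_mult:
  assumes F: "primitive S F f" and G: "primitive S G g"
  shows "primitive S (\<lambda>t. F t * G t) (\<lambda>t. f t * G t + F t * g t)"
proof -
  obtain N1 where N1: "negligible N1" "\<And>t. t \<in> {0..S} - N1 \<Longrightarrow> (F has_real_derivative f t) (at t within {0..S})"
    using primitive_derivative_ae[OF F] by blast
  obtain N2 where N2: "negligible N2" "\<And>t. t \<in> {0..S} - N2 \<Longrightarrow> (G has_real_derivative g t) (at t within {0..S})"
    using primitive_derivative_ae[OF G] by blast
  show ?thesis
  proof (rule primitiveI_abs_continuous)
    show "abs_continuous_on 0 S (\<lambda>t. F t * G t)"
      using F G by (intro abs_continuous_on_mult primitive_abs_continuous primitive_continuous)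
    show "(\<lambda>t. f t * G t + F t * g t) absolutely_integrable_on {0..S}"
      using primitiveD(1)[OF F] primitiveD(1)[OF G] primitive_continuous[OF F] primitive_continuous[OF G]
      by (intro set_integral_add continuous_mult_abs_integrable)
    show "negligible (N1 \<union> N2)" using N1(1) N2(1) by (rule negligible_Un)
    show "((\<lambda>t. F t * G t) has_real_derivative f t * G t + F t * g t) (at t within {0..S})"
      if t: "t \<in> {0..S} - (N1 \<union> N2)" for t
    proof -
      have "(F has_real_derivative f t) (at t within {0..S})" by (rule N1(2)) (use t in simp)
      moreover have "(G has_real_derivative g t) (at t within {0..S})" by (rule N2(2)) (use t in simp)
      ultimately show ?thesis using DERIV_mult by (fastforce simp: algebra_simps)
    qed
  qed
qed

lemma primitive_add:
  assumes F: "primitive S F f" and G: "primitive S G g"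
  shows "primitive S (\<lambda>t. F t + G t) (\<lambda>t. f t + g t)"
  unfolding primitive_def
proof (intro conjI ballI)
  show "(\<lambda>t. f t + g t) absolutely_integrable_on {0..S}"
    using primitiveD(1)[OF F] primitiveD(1)[OF G] by (rule set_integral_add)
  show "F t + G t = F 0 + G 0 + integral {0..t} (\<lambda>t. f t + g t)" if "t \<in> {0..S}" for t
    using primitiveD(2,3)[OF F that] primitiveD(2,3)[OF G that] by (simp add: integral_add)
qed

lemma primitive_cmult:
  assumes F: "primitive S F f"
  shows "primitive S (\<lambda>t. c * F t) (\<lambda>t. c * f t)"
  unfolding primitive_def
proof (intro conjI ballI)
  show "(\<lambda>t. c * f t) absolutely_integrable_on {0..S}"
    using primitiveD(1)[OF F] by simp
  show "c * F t = c * F 0 + integral {0..t} (\<lambda>t. c * f t)" if "t \<in> {0..S}" for t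
    using primitiveD(2)[OF F that] by (simp add: distrib_left)
qed

lemma primitive_diff:
  assumes "primitive S F f" "primitive S G g"
  shows "primitive S (\<lambda>t. F t - G t) (\<lambda>t. f t - g t)"
  using primitive_add[OF assms(1) primitive_cmult[OF assms(2), of "-1"]] by simp

lemma primitive_cong:
  assumes "primitive S F f" "\<And>t. t \<in> {0..S} \<Longrightarrow> F t = G t" "\<And>t. t \<in> {0..S} \<Longrightarrow> f t = g t"
  shows "primitive S G g"
  unfolding primitive_def
proof (intro conjI ballI)
  show "g absolutely_integrable_on {0..S}"
    using primitiveD(1)[OF assms(1)] assms(3) set_integrable_cong[of lebesgue lebesgue "{0..S}" "{0..S}" f g] by auto
  show "G t = G 0 + integral {0..t} g" if t: "t \<in> {0..S}" for t
  proof -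
    have "integral {0..t} g = integral {0..t} f"
      using t assms(3) by (intro Henstock_Kurzweil_Integration.integral_cong) auto
    then show ?thesis using primitiveD(2)[OF assms(1) t] assms(2)[OF t] assms(2)[of 0] t by simp
  qed
qed

lemma primitive_integral:
  assumes "f absolutely_integrable_on {0..S}"
  shows "primitive S (\<lambda>t. c + integral {0..t} f) f"
  using assms by (simp add: primitive_def)

lemma primitive_has_derivative:
  assumes u: "primitive S u v" and v: "continuous_on {0..S} v" and t: "t \<in> {0..S}"
  shows "(u has_real_derivative v t) (at t within {0..S})"
proof -
  have "((\<lambda>x. u 0 + integral {0..x} v) has_real_derivative 0 + v t) (at t within {0..S})"
    using integral_has_vector_derivative[OF v t]
    by (intro derivative_intros) (simp add: has_real_derivative_iff_has_vector_derivative)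
  then have "((\<lambda>x. u 0 + integral {0..x} v) has_real_derivative v t) (at t within {0..S})"
    by simp
  with t show ?thesis
    by (intro has_real_derivative_cong_on[OF _ primitiveD(2)[OF u, symmetric]]) auto
qed

lemma deriv_on_eq:
  assumes "S > 0" "t \<in> {0..S}" "(u has_real_derivative d) (at t within {0..S})"
  shows "deriv_on 0 S u t = d"
  using assms unfolding deriv_on_def
  by (intro vector_derivative_within_closed_interval) (auto simp: has_real_derivative_iff_has_vector_derivative)

text \<open>The boundary condition in terms of \<open>u(0)\<close>, \<open>u'(0)\<close>, \<open>u(S)\<close>, \<open>u'(S)\<close>, in this order.\<close>

fun bc :: "bdry \<Rightarrow> real \<Rightarrow> real \<Rightarrow> real \<Rightarrow> real \<Rightarrow> bool" where
  "bc Periodic u0 v0 u1 v1 \<longleftrightarrow> u0 = u1 \<and> v0 = v1"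
| "bc Neumann u0 v0 u1 v1 \<longleftrightarrow> v0 = 0 \<and> v1 = 0"

text \<open>The equation \<open>u'' + q u = \<sigma>\<close> as an integrated first-order system for \<open>u\<close> and \<open>v = u'\<close>. It has
  no almost everywhere quantifier and no derivative, so restricting, reflecting and gluing solutions is easy.\<close>

definition ode :: "real \<Rightarrow> (real \<Rightarrow> real) \<Rightarrow> (real \<Rightarrow> real) \<Rightarrow> (real \<Rightarrow> real) \<Rightarrow> (real \<Rightarrow> real) \<Rightarrow> bool" where
  "ode S q \<sigma> u v \<longleftrightarrow> primitive S u v \<and> primitive S v (\<lambda>t. \<sigma> t - q t * u t)"

lemma bvp_solution_iff_ode:
  assumes S: "S > 0" and q: "q absolutely_integrable_on {0..S}" and \<sigma>: "\<sigma> absolutely_integrable_on {0..S}"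
  shows "bvp_solution B q S \<sigma> u \<longleftrightarrow> (\<exists>v. ode S q \<sigma> u v \<and> bc B (u 0) (v 0) (u S) (v S))"
proof
  assume bvp: "bvp_solution B q S \<sigma> u"
  define v where "v = deriv_on 0 S u"
  have W: "u \<in> W21 0 S"
    and ae: "AE t in lebesgue_on {0..S}. \<exists>u2. (v has_real_derivative u2) (at t within {0..S}) \<and> u2 + q t * u t = \<sigma> t"
    and bc: "bdry_cond B S u"
    using bvp unfolding bvp_solution_def v_def by simp_all
  from W have u: "u differentiable_on {0..S}" and vc: "continuous_on {0..S} v" and vac: "abs_continuous_on 0 S v"
    unfolding W21_def v_def by simp_all
  have der: "(u has_real_derivative v t) (at t within {0..S})" if t: "t \<in> {0..S}" for t
  proof -
    obtain d where d: "(u has_real_derivative d) (at t within {0..S})"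
      using u t unfolding differentiable_on_def by (meson real_differentiable_def)
    then show ?thesis using deriv_on_eq[OF S t d] by (simp add: v_def)
  qed
  have uc: "continuous_on {0..S} u" using u by (rule differentiable_imp_continuous_on)
  have "primitive S u v"
    unfolding primitive_def
  proof (intro conjI ballI)
    show "v absolutely_integrable_on {0..S}" using vc by (rule absolutely_integrable_continuous_real)
    fix t assume t: "t \<in> {0..S}"
    have "(v has_integral (u t - u 0)) {0..t}"
      using t by (intro fundamental_theorem_of_calculus)
        (auto simp: has_real_derivative_iff_has_vector_derivative[symmetric] intro!: DERIV_subset[OF der])
    then show "u t = u 0 + integral {0..t} v" by (simp add: integral_unique)
  qed
  moreover have "primitive S v (\<lambda>t. \<sigma> t - q t * u t)"
  proof -
    have "AE t in lebesgue. t \<in> {0..S} \<longrightarrow> (\<exists>u2. (v has_real_derivative u2) (at t within {0..S}) \<and> u2 + q t * u t = \<sigma> t)"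
      using ae by (subst (asm) AE_restrict_space_iff) simp_all
    then obtain N where N: "negligible N" "{t. \<not> (t \<in> {0..S} \<longrightarrow> (\<exists>u2. (v has_real_derivative u2) (at t within {0..S}) \<and> u2 + q t * u t = \<sigma> t))} \<subseteq> N"
      unfolding eventually_ae_filter_negligible by blast
    show ?thesis
    proof (rule primitiveI_abs_continuous[OF vac _ N(1)])
      show "(\<lambda>t. \<sigma> t - q t * u t) absolutely_integrable_on {0..S}"
        by (intro set_integral_diff \<sigma> continuous_mult_abs_integrable(2) uc q)
      show "(v has_real_derivative \<sigma> t - q t * u t) (at t within {0..S})" if t: "t \<in> {0..S} - N" for t
      proof -
        obtain u2 where "(v has_real_derivative u2) (at t within {0..S})" "u2 + q t * u t = \<sigma> t"
          using N(2) t by blast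
        moreover from this have "u2 = \<sigma> t - q t * u t" by simp
        ultimately show ?thesis by simp
      qed
    qed
  qed
  moreover have "bc B (u 0) (v 0) (u S) (v S)"
    using bc by (cases B) (auto simp: v_def)
  ultimately show "\<exists>v. ode S q \<sigma> u v \<and> bc B (u 0) (v 0) (u S) (v S)" unfolding ode_def by blast
next
  assume "\<exists>v. ode S q \<sigma> u v \<and> bc B (u 0) (v 0) (u S) (v S)"
  then obtain v where u: "primitive S u v" and v: "primitive S v (\<lambda>t. \<sigma> t - q t * u t)"
    and bc: "bc B (u 0) (v 0) (u S) (v S)" unfolding ode_def by blast
  have vc: "continuous_on {0..S} v" by (rule primitive_continuous[OF v])
  have der: "(u has_real_derivative v t) (at t within {0..S})" if "t \<in> {0..S}" for t
    by (rule primitive_has_derivative[OF u vc that])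
  have eq: "deriv_on 0 S u t = v t" if "t \<in> {0..S}" for t
    by (rule deriv_on_eq[OF S that der[OF that]])
  have "u \<in> W21 0 S"
    unfolding W21_def
  proof (intro CollectI conjI)
    show "u differentiable_on {0..S}"
      using der unfolding differentiable_on_def by (meson real_differentiable_def)
    show "continuous_on {0..S} (deriv_on 0 S u)" by (rule continuous_on_eq[OF vc]) (rule eq[symmetric])
    show "abs_continuous_on 0 S (deriv_on 0 S u)"
      by (rule abs_continuous_on_cong[OF primitive_abs_continuous[OF v]]) (simp add: eq)
  qed
  moreover have "AE t in lebesgue_on {0..S}. \<exists>u2. (deriv_on 0 S u has_real_derivative u2) (at t within {0..S}) \<and> u2 + q t * u t = \<sigma> t"
  proof -
    obtain N where N: "negligible N" "\<And>t. t \<in> {0..S} - N \<Longrightarrow> (v has_real_derivative \<sigma> t - q t * u t) (at t within {0..S})"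
      using primitive_derivative_ae[OF v] by blast
    have "\<exists>u2. (deriv_on 0 S u has_real_derivative u2) (at t within {0..S}) \<and> u2 + q t * u t = \<sigma> t"
      if t: "t \<in> {0..S} - N" for t
    proof (intro exI conjI)
      show "(deriv_on 0 S u has_real_derivative \<sigma> t - q t * u t) (at t within {0..S})"
        by (rule has_real_derivative_cong_on[OF _ eq[symmetric] N(2)[OF t]]) (use t in auto)
    qed simp
    then have "AE t in lebesgue. t \<in> {0..S} \<longrightarrow> (\<exists>u2. (deriv_on 0 S u has_real_derivative u2) (at t within {0..S}) \<and> u2 + q t * u t = \<sigma> t)"
      unfolding eventually_ae_filter_negligible using N(1) by blast
    then show ?thesis by (subst AE_restrict_space_iff) simp_all
  qed
  moreover have "bdry_cond B S u"
    using bc eq S by (cases B) auto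
  ultimately show "bvp_solution B q S \<sigma> u" unfolding bvp_solution_def by blast
qed

section \<open>Initial value problems\<close>

text \<open>The operator \<open>w \<mapsto> \<integral>\<integral> q w\<close> behind \<open>u'' = - q u\<close> halves the norm \<open>sup \<bar>w s\<bar> exp (- l s)\<close>. The
  inner integral of the merely integrable \<open>q\<close> gains nothing from the weight, but the outer
  integral of \<open>exp (l r)\<close> gains a factor \<open>1 / l\<close>, and \<open>l\<close> exceeds twice the integral of \<open>\<bar>q\<bar>\<close>.\<close>

lemma double_integral_weighted_bound:
  fixes q w :: "real \<Rightarrow> real"
  assumes q: "q absolutely_integrable_on {0..S}" and w: "continuous_on {0..S} w"
    and M: "\<And>s. s \<in> {0..S} \<Longrightarrow> \<bar>w s\<bar> \<le> M * exp (l * s)" "M \<ge> 0"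
    and l: "l = 2 * integral {0..S} (\<lambda>s. \<bar>q s\<bar>) + 1" and t: "t \<in> {0..S}"
  shows "\<bar>integral {0..t} (\<lambda>r. integral {0..r} (\<lambda>s. q s * w s))\<bar> \<le> M / 2 * exp (l * t)"
proof -
  define Q where "Q = integral {0..S} (\<lambda>s. \<bar>q s\<bar>)"
  have qa: "(\<lambda>s. \<bar>q s\<bar>) absolutely_integrable_on {0..S}"
    using absolutely_integrable_norm[OF q] by (simp add: o_def)
  have Q: "Q \<ge> 0" unfolding Q_def by (rule Henstock_Kurzweil_Integration.integral_nonneg)
      (use qa set_lebesgue_integral_eq_integral(1) in auto)
  have lQ: "l = 2 * Q + 1" "l > 0" using l Q by (auto simp: Q_def)
  have qw: "(\<lambda>s. q s * w s) absolutely_integrable_on {0..S}"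
    by (rule continuous_mult_abs_integrable(2)[OF w q])
  have inner: "\<bar>integral {0..r} (\<lambda>s. q s * w s)\<bar> \<le> M * Q * exp (l * r)" if r: "r \<in> {0..S}" for r
  proof -
    have sub: "{0..r} \<subseteq> {0..S}" using r by simp
    have qr: "(\<lambda>s. \<bar>q s\<bar>) integrable_on {0..r}"
      by (rule abs_integrable_subinterval_integrable[OF qa sub])
    have "norm (integral {0..r} (\<lambda>s. q s * w s)) \<le> integral {0..r} (\<lambda>s. \<bar>q s\<bar> * (M * exp (l * r)))"
    proof (rule integral_norm_bound_integral)
      show "(\<lambda>s. q s * w s) integrable_on {0..r}"
        by (rule abs_integrable_subinterval_integrable[OF qw sub])
      show "(\<lambda>s. \<bar>q s\<bar> * (M * exp (l * r))) integrable_on {0..r}"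
        using qr by (rule integrable_on_mult_left)
      fix s assume s: "s \<in> {0..r}"
      have "\<bar>w s\<bar> \<le> M * exp (l * s)" using M(1) s r by simp
      also have "\<dots> \<le> M * exp (l * r)" using s lQ(2) M(2) by (intro mult_left_mono) auto
      finally show "norm (q s * w s) \<le> \<bar>q s\<bar> * (M * exp (l * r))"
        by (simp add: abs_mult mult_left_mono)
    qed
    also have "\<dots> = integral {0..r} (\<lambda>s. \<bar>q s\<bar>) * (M * exp (l * r))" by simp
    also have "\<dots> \<le> Q * (M * exp (l * r))"
      unfolding Q_def using M(2) qr sub qa set_lebesgue_integral_eq_integral(1)
      by (intro mult_right_mono integral_subset_le) auto
    finally show ?thesis by (simp add: ac_simps)
  qed
  have ex: "((\<lambda>r. M * Q * exp (l * r)) has_integral (M * Q / l * exp (l * t) - M * Q / l * exp (l * 0))) {0..t}"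
    using lQ(2) t
    by (intro fundamental_theorem_of_calculus)
      (auto simp: has_real_derivative_iff_has_vector_derivative[symmetric] intro!: derivative_eq_intros)
  have "norm (integral {0..t} (\<lambda>r. integral {0..r} (\<lambda>s. q s * w s))) \<le> integral {0..t} (\<lambda>r. M * Q * exp (l * r))"
  proof (rule integral_norm_bound_integral)
    have "continuous_on {0..S} (\<lambda>r. integral {0..r} (\<lambda>s. q s * w s))"
      using qw set_lebesgue_integral_eq_integral(1) by (intro indefinite_integral_continuous_1) blast
    then show "(\<lambda>r. integral {0..r} (\<lambda>s. q s * w s)) integrable_on {0..t}"
      by (intro integrable_continuous_real, rule continuous_on_subset) (use t in simp)
    show "(\<lambda>r. M * Q * exp (l * r)) integrable_on {0..t}" using ex by (rule has_integral_integrable)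
  qed (use inner t in simp)
  also have "\<dots> = M * Q / l * exp (l * t) - M * Q / l" using integral_unique[OF ex] by simp
  also have "\<dots> \<le> M * Q / l * exp (l * t)" using M(2) Q lQ(2) by simp
  also have "\<dots> \<le> M / 2 * exp (l * t)"
  proof (rule mult_right_mono)
    have "M * Q * 2 \<le> M * l" using M(2) lQ(1) by (simp add: mult_left_mono algebra_simps)
    then show "M * Q / l \<le> M / 2" using lQ(2) by (simp add: field_simps)
  qed simp
  finally show ?thesis by simp
qed

lemma ode_D:
  assumes "ode S q \<sigma> u v"
  shows "primitive S u v" "primitive S v (\<lambda>t. \<sigma> t - q t * u t)" "continuous_on {0..S} u" "continuous_on {0..S} v"
  using assms primitive_continuous unfolding ode_def by blast+

text \<open>Banach's fixed point theorem for \<open>u = \<alpha> + \<beta> t - \<integral>\<integral> q u\<close>. Bounded continuous functions live on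
  the whole line, hence the clamp \<open>c\<close> to \<open>[0,S]\<close>; the unknown is \<open>x = exp (- l t) u\<close>, so that the
  weighted norm becomes the usual one.\<close>

lemma ivp_exists:
  assumes S: "S \<ge> 0" and q: "q absolutely_integrable_on {0..S}"
  shows "\<exists>u v. ode S q (\<lambda>_. 0) u v \<and> u 0 = \<alpha> \<and> v 0 = \<beta>"
proof -
  define l where "l = 2 * integral {0..S} (\<lambda>s. \<bar>q s\<bar>) + 1"
  define c where "c = (\<lambda>t. max 0 (min S t))"
  have c: "c t \<in> {0..S}" "t \<in> {0..S} \<Longrightarrow> c t = t" for t using S by (auto simp: c_def)
  have cc: "continuous_on UNIV c" unfolding c_def by (intro continuous_intros)
  define K where "K = (\<lambda>w t. integral {0..t} (\<lambda>r. integral {0..r} (\<lambda>s. q s * w s)))"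
  have qw: "(\<lambda>s. q s * w s) integrable_on {0..r}" if "continuous_on {0..S} w" "r \<in> {0..S}" for w r
    by (rule abs_integrable_subinterval_integrable[OF continuous_mult_abs_integrable(2)[OF that(1) q]]) (use that(2) in simp)
  have qwc: "continuous_on {0..S} (\<lambda>r. integral {0..r} (\<lambda>s. q s * w s))" if "continuous_on {0..S} w" for w
    using qw[OF that, of S] S by (intro indefinite_integral_continuous_1) simp
  have Kc: "continuous_on {0..S} (K w)" if "continuous_on {0..S} w" for w
    unfolding K_def by (intro indefinite_integral_continuous_1 integrable_continuous_real qwc that)
  have Kdiff: "K w1 t - K w2 t = K (\<lambda>s. w1 s - w2 s) t"
    if w: "continuous_on {0..S} w1" "continuous_on {0..S} w2" and t: "t \<in> {0..S}" for w1 w2 t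
  proof -
    have "K (\<lambda>s. w1 s - w2 s) t = integral {0..t} (\<lambda>r. integral {0..r} (\<lambda>s. q s * w1 s) - integral {0..r} (\<lambda>s. q s * w2 s))"
      unfolding K_def
    proof (rule Henstock_Kurzweil_Integration.integral_cong)
      fix r assume "r \<in> {0..t}"
      then have r: "r \<in> {0..S}" using t by simp
      show "integral {0..r} (\<lambda>s. q s * (w1 s - w2 s)) = integral {0..r} (\<lambda>s. q s * w1 s) - integral {0..r} (\<lambda>s. q s * w2 s)"
        using integral_diff[OF qw[OF w(1) r] qw[OF w(2) r]] by (simp add: right_diff_distrib)
    qed
    also have "\<dots> = K w1 t - K w2 t"
      unfolding K_def using t
      by (intro integral_diff integrable_continuous_real continuous_on_subset[OF qwc[OF w(1)]] continuous_on_subset[OF qwc[OF w(2)]]) auto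
    finally show ?thesis by simp
  qed
  define g where "g = (\<lambda>(x :: real \<Rightarrow>\<^sub>C real) t. exp (- l * t) * (\<alpha> + \<beta> * t - K (\<lambda>s. exp (l * s) * x s) t))"
  have xc: "continuous_on {0..S} (\<lambda>s. exp (l * s) * x s)" for x :: "real \<Rightarrow>\<^sub>C real"
    by (intro continuous_intros) auto
  have gc: "continuous_on {0..S} (g x)" for x
    unfolding g_def by (intro continuous_intros Kc xc)
  define \<Phi> where "\<Phi> = (\<lambda>x. Bcontfun (\<lambda>t. g x (c t)))"
  have app: "apply_bcontfun (\<Phi> x) t = g x (c t)" for x t
  proof -
    have "continuous_on UNIV (\<lambda>t. g x (c t))"
      by (rule continuous_on_compose2[OF gc cc]) (use c in auto)
    moreover have "bounded (range (\<lambda>t. g x (c t)))"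
      by (rule bounded_subset[OF compact_imp_bounded[OF compact_continuous_image[OF gc[of x]]]]) (use c in auto)
    ultimately have "(\<lambda>t. g x (c t)) \<in> bcontfun" by (simp add: bcontfun_def)
    then show ?thesis unfolding \<Phi>_def by (simp add: Bcontfun_inverse)
  qed
  have "dist (\<Phi> x) (\<Phi> y) \<le> 1/2 * dist x y" for x y
  proof (rule dist_bound)
    fix t
    define r where "r = c t"
    have r: "r \<in> {0..S}" using c by (simp add: r_def)
    define w where "w = (\<lambda>s. exp (l * s) * x s - exp (l * s) * y s)"
    have wc: "continuous_on {0..S} w" unfolding w_def by (intro continuous_intros xc)
    have wb: "\<bar>w s\<bar> \<le> dist x y * exp (l * s)" for s
    proof -
      have "w s = exp (l * s) * (x s - y s)" by (simp add: w_def right_diff_distrib)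
      then have "\<bar>w s\<bar> = exp (l * s) * dist (x s) (y s)" by (simp add: abs_mult dist_real_def)
      also have "\<dots> \<le> exp (l * s) * dist x y" by (intro mult_left_mono dist_bounded) simp
      finally show ?thesis by (simp add: mult.commute)
    qed
    have "g x r - g y r = - exp (- l * r) * K w r"
      unfolding w_def Kdiff[OF xc xc r, symmetric] g_def by (simp add: algebra_simps)
    then have "dist (\<Phi> x t) (\<Phi> y t) = exp (- l * r) * \<bar>K w r\<bar>"
      unfolding app r_def[symmetric] dist_real_def by (simp add: abs_mult)
    also have "\<dots> \<le> exp (- l * r) * (dist x y / 2 * exp (l * r))"
      unfolding K_def by (intro mult_left_mono double_integral_weighted_bound[OF q wc wb _ l_def r]) auto
    also have "\<dots> = 1/2 * dist x y" by (simp add: exp_minus field_simps)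
    finally show "dist (\<Phi> x t) (\<Phi> y t) \<le> 1/2 * dist x y" .
  qed
  then obtain x where x: "\<Phi> x = x" using banach_fix_type[of "1/2" \<Phi>] by auto
  define u where "u = (\<lambda>t. exp (l * t) * x t)"
  define v where "v = (\<lambda>t. \<beta> - integral {0..t} (\<lambda>s. q s * u s))"
  have uc: "continuous_on {0..S} u" unfolding u_def by (rule xc)
  have ueq: "u t = \<alpha> + \<beta> * t - K u t" if t: "t \<in> {0..S}" for t
  proof -
    have "x t = g x t" using app[of x t] x c(2)[OF t] by simp
    then have "u t = exp (l * t) * g x t" by (simp add: u_def)
    also have "\<dots> = \<alpha> + \<beta> * t - K u t" unfolding g_def u_def by (simp add: exp_minus field_simps)
    finally show ?thesis .
  qed
  have u0: "u 0 = \<alpha>" using ueq[of 0] S by (simp add: K_def)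
  have v0: "v 0 = \<beta>" by (simp add: v_def)
  have "primitive S v (\<lambda>t. 0 - q t * u t)"
    unfolding primitive_def
  proof (intro conjI ballI)
    show "(\<lambda>t. 0 - q t * u t) absolutely_integrable_on {0..S}"
      by (intro set_integral_diff absolutely_integrable_zero continuous_mult_abs_integrable(2)[OF uc q])
    show "v t = v 0 + integral {0..t} (\<lambda>t. 0 - q t * u t)" for t by (simp add: v_def)
  qed
  moreover have "primitive S u v"
    unfolding primitive_def
  proof (intro conjI ballI)
    show "v absolutely_integrable_on {0..S}"
      unfolding v_def by (intro absolutely_integrable_continuous_real continuous_intros qwc uc)
    fix t assume t: "t \<in> {0..S}"
    have "integral {0..t} v = integral {0..t} (\<lambda>r. \<beta>) - integral {0..t} (\<lambda>r. integral {0..r} (\<lambda>s. q s * u s))"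
      unfolding v_def using t
      by (intro integral_diff integrable_continuous_real continuous_on_subset[OF qwc[OF uc]]) auto
    then show "u t = u 0 + integral {0..t} v" using ueq[OF t] u0 t by (simp add: K_def)
  qed
  ultimately show ?thesis unfolding ode_def using u0 v0 by blast
qed

lemma ode_add:
  assumes "ode S q \<sigma> u v" "ode S q \<tau> u' v'"
  shows "ode S q (\<lambda>t. \<sigma> t + \<tau> t) (\<lambda>t. u t + u' t) (\<lambda>t. v t + v' t)"
proof -
  have "primitive S (\<lambda>t. v t + v' t) (\<lambda>t. (\<sigma> t - q t * u t) + (\<tau> t - q t * u' t))"
    using assms unfolding ode_def by (intro primitive_add) auto
  also have "(\<lambda>t. (\<sigma> t - q t * u t) + (\<tau> t - q t * u' t)) = (\<lambda>t. \<sigma> t + \<tau> t - q t * (u t + u' t))"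
    by (simp add: algebra_simps)
  finally show ?thesis using assms unfolding ode_def by (auto intro: primitive_add)
qed

lemma ode_cmult:
  assumes "ode S q \<sigma> u v"
  shows "ode S q (\<lambda>t. c * \<sigma> t) (\<lambda>t. c * u t) (\<lambda>t. c * v t)"
proof -
  have "primitive S (\<lambda>t. c * v t) (\<lambda>t. c * (\<sigma> t - q t * u t))"
    using assms unfolding ode_def by (intro primitive_cmult) auto
  also have "(\<lambda>t. c * (\<sigma> t - q t * u t)) = (\<lambda>t. c * \<sigma> t - q t * (c * u t))"
    by (simp add: algebra_simps)
  finally show ?thesis using assms unfolding ode_def by (auto intro: primitive_cmult)
qed

lemma ode_cong:
  assumes "ode S q \<sigma> u v"
    and "\<And>t. t \<in> {0..S} \<Longrightarrow> \<sigma> t = \<sigma>' t" "\<And>t. t \<in> {0..S} \<Longrightarrow> q t = q' t"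
    and "\<And>t. t \<in> {0..S} \<Longrightarrow> u t = u' t" "\<And>t. t \<in> {0..S} \<Longrightarrow> v t = v' t"
  shows "ode S q' \<sigma>' u' v'"
  unfolding ode_def
proof
  show "primitive S u' v'" by (rule primitive_cong[OF ode_D(1)[OF assms(1)] assms(4,5)])
  show "primitive S v' (\<lambda>t. \<sigma>' t - q' t * u' t)"
    by (rule primitive_cong[OF ode_D(2)[OF assms(1)] assms(5)]) (simp_all add: assms)
qed

text \<open>The Wronskian \<open>p1 d2 - p2 d1\<close> has derivative 0, so it stays equal to 1; this is what makes the
  second derivative produce \<open>\<sigma>\<close> with coefficient 1.\<close>

lemma variation_of_parameters:
  assumes S: "S \<ge> 0" and 1: "ode S q (\<lambda>_. 0) p1 d1" "p1 0 = 1" "d1 0 = 0"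
    and 2: "ode S q (\<lambda>_. 0) p2 d2" "p2 0 = 0" "d2 0 = 1"
    and \<sigma>: "\<sigma> absolutely_integrable_on {0..S}"
  defines "A \<equiv> \<lambda>t. integral {0..t} (\<lambda>s. p1 s * \<sigma> s)" and "B \<equiv> \<lambda>t. integral {0..t} (\<lambda>s. p2 s * \<sigma> s)"
  shows "ode S q \<sigma> (\<lambda>t. p2 t * A t - p1 t * B t) (\<lambda>t. d2 t * A t - d1 t * B t)"
proof -
  note o1 = ode_D[OF 1(1)] and o2 = ode_D[OF 2(1)]
  have W: "p1 t * d2 t - p2 t * d1 t = 1" if t: "t \<in> {0..S}" for t
  proof -
    have "primitive S (\<lambda>t. p1 t * d2 t - p2 t * d1 t)
       (\<lambda>t. (d1 t * d2 t + p1 t * (0 - q t * p2 t)) - (d2 t * d1 t + p2 t * (0 - q t * p1 t)))"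
      by (intro primitive_diff primitive_mult o1 o2)
    then have "primitive S (\<lambda>t. p1 t * d2 t - p2 t * d1 t) (\<lambda>t. 0)"
      by (rule primitive_cong) (simp_all add: algebra_simps)
    from primitiveD(2)[OF this t] show ?thesis using 1 2 by simp
  qed
  have A: "primitive S A (\<lambda>t. p1 t * \<sigma> t)"
    using primitive_integral[OF continuous_mult_abs_integrable(1)[OF o1(3) \<sigma>], of 0] by (simp add: A_def)
  have B: "primitive S B (\<lambda>t. p2 t * \<sigma> t)"
    using primitive_integral[OF continuous_mult_abs_integrable(1)[OF o2(3) \<sigma>], of 0] by (simp add: B_def)
  have "primitive S (\<lambda>t. p2 t * A t - p1 t * B t)
     (\<lambda>t. (d2 t * A t + p2 t * (p1 t * \<sigma> t)) - (d1 t * B t + p1 t * (p2 t * \<sigma> t)))"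
    by (intro primitive_diff primitive_mult o1 o2 A B)
  then have "primitive S (\<lambda>t. p2 t * A t - p1 t * B t) (\<lambda>t. d2 t * A t - d1 t * B t)"
    by (rule primitive_cong) (simp_all add: algebra_simps)
  moreover have "primitive S (\<lambda>t. d2 t * A t - d1 t * B t)
     (\<lambda>t. ((0 - q t * p2 t) * A t + d2 t * (p1 t * \<sigma> t)) - ((0 - q t * p1 t) * B t + d1 t * (p2 t * \<sigma> t)))"
    by (intro primitive_diff primitive_mult o1 o2 A B)
  then have "primitive S (\<lambda>t. d2 t * A t - d1 t * B t) (\<lambda>t. \<sigma> t - q t * (p2 t * A t - p1 t * B t))"
  proof (rule primitive_cong)
    fix t assume t: "t \<in> {0..S}"
    have "(0 - q t * p2 t) * A t + d2 t * (p1 t * \<sigma> t) - ((0 - q t * p1 t) * B t + d1 t * (p2 t * \<sigma> t)) =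
      (p1 t * d2 t - p2 t * d1 t) * \<sigma> t - q t * (p2 t * A t - p1 t * B t)" by (simp add: algebra_simps)
    then show "(0 - q t * p2 t) * A t + d2 t * (p1 t * \<sigma> t) - ((0 - q t * p1 t) * B t + d1 t * (p2 t * \<sigma> t)) =
      \<sigma> t - q t * (p2 t * A t - p1 t * B t)" using W[OF t] by simp
  qed simp
  ultimately show ?thesis unfolding ode_def ..
qed

section \<open>Existence and uniqueness of the Green's function\<close>

text \<open>Both boundary conditions as a pair of linear equations, so that one construction serves both.\<close>

lemma bc_linear_conditions:
  obtains a1 b1 c1 e1 a2 b2 c2 e2 where
    "\<And>u0 v0 u1 v1. bc B u0 v0 u1 v1 \<longleftrightarrow>
       a1 * u0 + b1 * v0 + c1 * u1 + e1 * v1 = 0 \<and> a2 * u0 + b2 * v0 + c2 * u1 + e2 * v1 = 0"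
proof (cases B)
  case Periodic
  then show ?thesis using that[of 1 0 "-1" 0 0 1 0 "-1"] by simp
next
  case Neumann
  then show ?thesis using that[of 0 1 0 0 0 0 0 1] by simp
qed

lemma bc_diff:
  assumes "bc B u0 v0 u1 v1" "bc B u0' v0' u1' v1'"
  shows "bc B (u0 - u0') (v0 - v0') (u1 - u1') (v1 - v1')"
  using assms by (cases B) auto

lemma nonresonantD:
  assumes "nonresonant B q S" "S > 0" "q absolutely_integrable_on {0..S}"
    and "ode S q (\<lambda>_. 0) u v" "bc B (u 0) (v 0) (u S) (v S)" "t \<in> {0..S}"
  shows "u t = 0"
proof -
  have "bvp_solution B q S (\<lambda>_. 0) u"
    unfolding bvp_solution_iff_ode[OF assms(2,3) absolutely_integrable_zero] using assms(4,5) by blast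
  then show ?thesis using assms(1,6) unfolding nonresonant_def by blast
qed

lemma ode_derivative_unique:
  assumes S: "S > 0" and 1: "ode S q \<sigma> u v" and 2: "ode S q' \<sigma>' u v'" and t: "t \<in> {0..S}"
  shows "v t = v' t"
proof -
  have "deriv_on 0 S u t = v t"
    by (rule deriv_on_eq[OF S t primitive_has_derivative[OF ode_D(1)[OF 1] ode_D(4)[OF 1] t]])
  moreover have "deriv_on 0 S u t = v' t"
    by (rule deriv_on_eq[OF S t primitive_has_derivative[OF ode_D(1)[OF 2] ode_D(4)[OF 2] t]])
  ultimately show ?thesis by simp
qed

lemma kernel_section_continuous:
  assumes G: "continuous_on ({0..S} \<times> {0..S}) (\<lambda>(t, s). G t s)" and t: "t \<in> {0..S::real}"
  shows "continuous_on {0..S} (G t)"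
proof -
  have "continuous_on {0..S} (\<lambda>s. (\<lambda>(t, s). G t s) (t, s))"
    by (rule continuous_on_compose2[OF G]) (use t in \<open>auto intro!: continuous_intros\<close>)
  then show ?thesis by simp
qed

lemma set_lebesgue_integral_kernel:
  fixes G :: "real \<Rightarrow> real \<Rightarrow> real"
  assumes G: "continuous_on ({0..S} \<times> {0..S}) (\<lambda>(t, s). G t s)" and t: "t \<in> {0..S}"
    and \<sigma>: "\<sigma> absolutely_integrable_on {0..S::real}"
  shows "(\<lambda>s. G t s * \<sigma> s) absolutely_integrable_on {0..S}"
    and "(LINT s:{0..S}|lebesgue. G t s * \<sigma> s) = integral {0..S} (\<lambda>s. G t s * \<sigma> s)"
proof -
  show a: "(\<lambda>s. G t s * \<sigma> s) absolutely_integrable_on {0..S}"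
    by (rule continuous_mult_abs_integrable(1)[OF kernel_section_continuous[OF G t] \<sigma>])
  show "(LINT s:{0..S}|lebesgue. G t s * \<sigma> s) = integral {0..S} (\<lambda>s. G t s * \<sigma> s)"
    by (rule set_lebesgue_integral_eq_integral(2)[OF a])
qed

text \<open>The solution vanishing to first order at 0 is given by the kernel
  \<open>p1 s p2 t - p2 s p1 t\<close> for \<open>s \<le> t\<close> and 0 otherwise. As it vanishes for \<open>s = t\<close>, replacing
  \<open>s\<close> by \<open>min s t\<close> writes it without case distinction and shows its continuity. The boundary conditions are met by
  adding a combination of \<open>p1\<close> and \<open>p2\<close>, whose coefficients solve a \<open>2 \<times> 2\<close> system \<open>M\<close>; nonresonance says that
  \<open>M\<close> is invertible. The right-hand side depends on \<open>\<sigma>\<close> only through the integrals of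
  \<open>p1 \<sigma>\<close> and \<open>p2 \<sigma>\<close> over \<open>[0,S]\<close>, hence the constants \<open>\<mu>\<close>, \<open>\<nu>\<close> and, by Cramer's rule, \<open>x\<close>, \<open>y\<close>.\<close>

theorem green_exists:
  assumes S: "S > 0" and q: "q absolutely_integrable_on {0..S}" and nonres: "nonresonant B q S"
  shows "\<exists>G. is_green B q S G"
proof -
  obtain a1 b1 c1 e1 a2 b2 c2 e2 where bc: "\<And>u0 v0 u1 v1. bc B u0 v0 u1 v1 \<longleftrightarrow>
       a1 * u0 + b1 * v0 + c1 * u1 + e1 * v1 = 0 \<and> a2 * u0 + b2 * v0 + c2 * u1 + e2 * v1 = 0"
    by (rule bc_linear_conditions[of B]) blast
  obtain p1 d1 where 1: "ode S q (\<lambda>_. 0) p1 d1" "p1 0 = 1" "d1 0 = 0"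
    using ivp_exists[OF less_imp_le[OF S] q] by blast
  obtain p2 d2 where 2: "ode S q (\<lambda>_. 0) p2 d2" "p2 0 = 0" "d2 0 = 1"
    using ivp_exists[OF less_imp_le[OF S] q] by blast
  note o1 = ode_D[OF 1(1)] and o2 = ode_D[OF 2(1)]
  define M11 M12 M21 M22 where
    "M11 = a1 * p1 0 + b1 * d1 0 + c1 * p1 S + e1 * d1 S" and
    "M12 = a1 * p2 0 + b1 * d2 0 + c1 * p2 S + e1 * d2 S" and
    "M21 = a2 * p1 0 + b2 * d1 0 + c2 * p1 S + e2 * d1 S" and
    "M22 = a2 * p2 0 + b2 * d2 0 + c2 * p2 S + e2 * d2 S"
  note M_defs = M11_def M12_def M21_def M22_def
  define D where "D = M11 * M22 - M12 * M21"
  \<comment> \<open>A vector in the kernel of \<open>M\<close> gives a solution of the homogeneous problem.\<close>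
  have kernel_trivial: "x = 0 \<and> y = 0" if "M11 * x + M12 * y = 0" "M21 * x + M22 * y = 0" for x y
  proof -
    define u v where "u = (\<lambda>t. x * p1 t + y * p2 t)" and "v = (\<lambda>t. x * d1 t + y * d2 t)"
    have "ode S q (\<lambda>_. x * 0 + y * 0) u v"
      unfolding u_def v_def by (intro ode_add ode_cmult 1 2)
    then have ode: "ode S q (\<lambda>_. 0) u v" by simp
    have "bc B (u 0) (v 0) (u S) (v S)"
      unfolding bc u_def v_def using that by (simp add: M_defs algebra_simps)
    then have u0: "u t = 0" if "t \<in> {0..S}" for t
      using nonresonantD[OF nonres S q ode _ that] by blast
    have "ode S q (\<lambda>_. 0) u (\<lambda>_. 0)"
      by (rule ode_cong[of _ q "\<lambda>_. 0" "\<lambda>_. 0" "\<lambda>_. 0"]) (auto simp: ode_def primitive_def u0)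
    then have "v 0 = 0" using ode_derivative_unique[OF S ode, of q "\<lambda>_. 0" "\<lambda>_. 0" 0] S by simp
    moreover have "u 0 = 0" using u0[of 0] S by simp
    ultimately show ?thesis using 1 2 by (simp add: u_def v_def)
  qed
  have D: "D \<noteq> 0"
  proof
    assume "D = 0"
    then have "M22 = 0 \<and> - M21 = 0" "M12 = 0 \<and> - M11 = 0"
      by (intro kernel_trivial; simp add: D_def algebra_simps)+
    then show False using kernel_trivial[of 1 0] by simp
  qed
  \<comment> \<open>Condition \<open>i\<close> on the particular solution equals \<open>\<mu>\<^sub>i\<close> times the integral of \<open>p1 \<sigma>\<close> plus \<open>\<nu>\<^sub>i\<close> times that of \<open>p2 \<sigma>\<close>.\<close>
  define \<mu>1 \<nu>1 \<mu>2 \<nu>2 where "\<mu>1 = c1 * p2 S + e1 * d2 S" and "\<nu>1 = - (c1 * p1 S + e1 * d1 S)"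
    and "\<mu>2 = c2 * p2 S + e2 * d2 S" and "\<nu>2 = - (c2 * p1 S + e2 * d1 S)"
  note mn_defs = \<mu>1_def \<nu>1_def \<mu>2_def \<nu>2_def
  define x1 y1 x2 y2 where "x1 = (M12 * \<mu>2 - M22 * \<mu>1) / D" and "y1 = (M12 * \<nu>2 - M22 * \<nu>1) / D"
    and "x2 = (M21 * \<mu>1 - M11 * \<mu>2) / D" and "y2 = (M21 * \<nu>1 - M11 * \<nu>2) / D"
  note xy_defs = x1_def y1_def x2_def y2_def
  have cramer: "M11 * x1 + M12 * x2 = - \<mu>1" "M11 * y1 + M12 * y2 = - \<nu>1"
    "M21 * x1 + M22 * x2 = - \<mu>2" "M21 * y1 + M22 * y2 = - \<nu>2"
  proof -
    have "D * (M11 * x1 + M12 * x2) = D * - \<mu>1" "D * (M11 * y1 + M12 * y2) = D * - \<nu>1"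
      "D * (M21 * x1 + M22 * x2) = D * - \<mu>2" "D * (M21 * y1 + M22 * y2) = D * - \<nu>2"
      using D unfolding xy_defs by (simp_all add: distrib_left) (simp_all add: D_def algebra_simps)
    then show "M11 * x1 + M12 * x2 = - \<mu>1" "M11 * y1 + M12 * y2 = - \<nu>1"
      "M21 * x1 + M22 * x2 = - \<mu>2" "M21 * y1 + M22 * y2 = - \<nu>2"
      unfolding mult_left_cancel[OF D] by - assumption+
  qed
  define G where "G = (\<lambda>t s. (p2 t * p1 (min s t) - p1 t * p2 (min s t)) +
     (p1 t * (x1 * p1 s + y1 * p2 s) + p2 t * (x2 * p1 s + y2 * p2 s)))"
  have Gc: "continuous_on ({0..S} \<times> {0..S}) (\<lambda>(t, s). G t s)"
  proof -
    have f: "continuous_on ({0..S} \<times> {0..S}) (\<lambda>z. h (fst z))" and s: "continuous_on ({0..S} \<times> {0..S}) (\<lambda>z. h (snd z))"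
      and m: "continuous_on ({0..S} \<times> {0..S}) (\<lambda>z. h (min (snd z) (fst z)))"
      if h: "continuous_on {0..S} h" for h :: "real \<Rightarrow> real"
      by (rule continuous_on_compose2[OF h]; force intro!: continuous_intros)+
    show ?thesis unfolding G_def split_def
      by (intro continuous_intros f s m o1 o2)
  qed
  have main: "\<exists>V. ode S q \<sigma> (\<lambda>t. integral {0..S} (\<lambda>s. G t s * \<sigma> s)) V \<and>
      bc B (integral {0..S} (\<lambda>s. G 0 s * \<sigma> s)) (V 0) (integral {0..S} (\<lambda>s. G S s * \<sigma> s)) (V S)"
    if \<sigma>: "\<sigma> absolutely_integrable_on {0..S}" for \<sigma>
  proof -
    define A where "A = (\<lambda>t. integral {0..t} (\<lambda>s. p1 s * \<sigma> s))"
    define C where "C = (\<lambda>t. integral {0..t} (\<lambda>s. p2 s * \<sigma> s))"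
    define \<gamma>1 \<gamma>2 where "\<gamma>1 = x1 * A S + y1 * C S" and "\<gamma>2 = x2 * A S + y2 * C S"
    define W where "W = (\<lambda>t. (p2 t * A t - p1 t * C t) + (\<gamma>1 * p1 t + \<gamma>2 * p2 t))"
    define V where "V = (\<lambda>t. (d2 t * A t - d1 t * C t) + (\<gamma>1 * d1 t + \<gamma>2 * d2 t))"
    have "ode S q (\<lambda>t. \<sigma> t + (\<gamma>1 * 0 + \<gamma>2 * 0)) W V"
      unfolding W_def V_def A_def C_def
      by (intro ode_add ode_cmult 1(1) 2(1) variation_of_parameters[OF less_imp_le[OF S] 1 2 \<sigma>])
    then have ode: "ode S q \<sigma> W V" by simp
    have i1: "(\<lambda>s. p1 s * \<sigma> s) absolutely_integrable_on {0..S}" and i2: "(\<lambda>s. p2 s * \<sigma> s) absolutely_integrable_on {0..S}"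
      by (rule continuous_mult_abs_integrable(1)[OF _ \<sigma>], rule o1 o2)+
    have W: "integral {0..S} (\<lambda>s. G t s * \<sigma> s) = W t" if t: "t \<in> {0..S}" for t
    proof -
      have hi: "(p1' has_integral integral {0..r} p1') {0..r}" if "p1' absolutely_integrable_on {0..S}" "r \<in> {0..S}" for p1' :: "real \<Rightarrow> real" and r
        by (rule integrable_integral, rule abs_integrable_subinterval_integrable[OF that(1)]) (use that(2) in simp)
      have "((\<lambda>s. p2 t * (p1 s * \<sigma> s) - p1 t * (p2 s * \<sigma> s)) has_integral (p2 t * A t - p1 t * C t)) {0..t}"
        unfolding A_def C_def by (intro has_integral_diff has_integral_mult_right hi i1 i2 t)
      then have l: "((\<lambda>s. (p2 t * p1 (min s t) - p1 t * p2 (min s t)) * \<sigma> s) has_integral (p2 t * A t - p1 t * C t)) {0..t}"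
        by (rule has_integral_eq[rotated]) (simp add: min_def algebra_simps)
      have r: "((\<lambda>s. (p2 t * p1 (min s t) - p1 t * p2 (min s t)) * \<sigma> s) has_integral 0) {t..S}"
        by (rule has_integral_is_0) (auto simp: min_def)
      have k: "((\<lambda>s. (p2 t * p1 (min s t) - p1 t * p2 (min s t)) * \<sigma> s) has_integral (p2 t * A t - p1 t * C t)) {0..S}"
        using has_integral_combine[OF _ _ l r] t by simp
      have "((\<lambda>s. p1 t * (x1 * (p1 s * \<sigma> s) + y1 * (p2 s * \<sigma> s)) + p2 t * (x2 * (p1 s * \<sigma> s) + y2 * (p2 s * \<sigma> s)))
          has_integral (p1 t * (x1 * A S + y1 * C S) + p2 t * (x2 * A S + y2 * C S))) {0..S}"
        unfolding A_def C_def using S by (intro has_integral_add has_integral_mult_right hi i1 i2) auto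
      from has_integral_add[OF k this]
      have "((\<lambda>s. G t s * \<sigma> s) has_integral W t) {0..S}"
        unfolding G_def W_def \<gamma>1_def \<gamma>2_def by (simp add: algebra_simps)
      then show ?thesis by (rule integral_unique)
    qed
    have "bc B (W 0) (V 0) (W S) (V S)"
      unfolding bc
    proof
      have [simp]: "A 0 = 0" "C 0 = 0" by (simp_all add: A_def C_def)
      have "a1 * W 0 + b1 * V 0 + c1 * W S + e1 * V S = \<mu>1 * A S + \<nu>1 * C S + (M11 * \<gamma>1 + M12 * \<gamma>2)"
        unfolding W_def V_def mn_defs M_defs by (simp add: algebra_simps)
      also have "M11 * \<gamma>1 + M12 * \<gamma>2 = (M11 * x1 + M12 * x2) * A S + (M11 * y1 + M12 * y2) * C S"
        unfolding \<gamma>1_def \<gamma>2_def by (simp add: algebra_simps)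
      finally show "a1 * W 0 + b1 * V 0 + c1 * W S + e1 * V S = 0" unfolding cramer by simp
      have "a2 * W 0 + b2 * V 0 + c2 * W S + e2 * V S = \<mu>2 * A S + \<nu>2 * C S + (M21 * \<gamma>1 + M22 * \<gamma>2)"
        unfolding W_def V_def mn_defs M_defs by (simp add: algebra_simps)
      also have "M21 * \<gamma>1 + M22 * \<gamma>2 = (M21 * x1 + M22 * x2) * A S + (M21 * y1 + M22 * y2) * C S"
        unfolding \<gamma>1_def \<gamma>2_def by (simp add: algebra_simps)
      finally show "a2 * W 0 + b2 * V 0 + c2 * W S + e2 * V S = 0" unfolding cramer by simp
    qed
    moreover have "ode S q \<sigma> (\<lambda>t. integral {0..S} (\<lambda>s. G t s * \<sigma> s)) V"
      by (rule ode_cong[OF ode]) (simp_all add: W)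
    ultimately show ?thesis using W[of 0] W[of S] S by (intro exI[of _ V]) simp
  qed
  have "bvp_solution B q S \<sigma> u \<longleftrightarrow> (\<forall>t\<in>{0..S}. u t = (LINT s:{0..S}|lebesgue. G t s * \<sigma> s))"
    if \<sigma>: "\<sigma> absolutely_integrable_on {0..S}" for \<sigma> u
  proof -
    define W where "W = (\<lambda>t. integral {0..S} (\<lambda>s. G t s * \<sigma> s))"
    have LW: "(LINT s:{0..S}|lebesgue. G t s * \<sigma> s) = W t" if "t \<in> {0..S}" for t
      unfolding W_def by (rule set_lebesgue_integral_kernel(2)[OF Gc that \<sigma>])
    obtain V where V: "ode S q \<sigma> W V" "bc B (W 0) (V 0) (W S) (V S)"
      using main[OF \<sigma>] unfolding W_def by blast
    show ?thesis
    proof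
      assume "bvp_solution B q S \<sigma> u"
      then obtain v where v: "ode S q \<sigma> u v" "bc B (u 0) (v 0) (u S) (v S)"
        unfolding bvp_solution_iff_ode[OF S q \<sigma>] by blast
      have "ode S q (\<lambda>t. \<sigma> t + (- 1) * \<sigma> t) (\<lambda>t. u t + (- 1) * W t) (\<lambda>t. v t + (- 1) * V t)"
        by (intro ode_add ode_cmult v V)
      then have "ode S q (\<lambda>_. 0) (\<lambda>t. u t - W t) (\<lambda>t. v t - V t)" by simp
      from nonresonantD[OF nonres S q this bc_diff[OF v(2) V(2)]]
      show "\<forall>t\<in>{0..S}. u t = (LINT s:{0..S}|lebesgue. G t s * \<sigma> s)" using LW by simp
    next
      assume "\<forall>t\<in>{0..S}. u t = (LINT s:{0..S}|lebesgue. G t s * \<sigma> s)"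
      then have u: "W t = u t" if "t \<in> {0..S}" for t using LW that by simp
      have "ode S q \<sigma> u V" by (rule ode_cong[OF V(1)]) (simp_all add: u)
      moreover have "bc B (u 0) (V 0) (u S) (V S)" using V(2) u[of 0] u[of S] S by simp
      ultimately show "bvp_solution B q S \<sigma> u" unfolding bvp_solution_iff_ode[OF S q \<sigma>] by blast
    qed
  qed
  then have "is_green B q S G" unfolding is_green_def using Gc by blast
  then show "\<exists>G. is_green B q S G" by (intro exI[of _ G])
qed

text \<open>Testing with the difference \<open>g - h\<close> itself gives a continuous square with integral 0.\<close>

lemma kernel_eqI:
  fixes g h :: "real \<Rightarrow> real"
  assumes S: "S > 0" and g: "continuous_on {0..S} g" and h: "continuous_on {0..S} h"
    and eq: "\<And>\<sigma>. \<sigma> absolutely_integrable_on {0..S} \<Longrightarrow>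
       integral {0..S} (\<lambda>s. g s * \<sigma> s) = integral {0..S} (\<lambda>s. h s * \<sigma> s)"
    and s: "s \<in> {0..S}"
  shows "g s = h s"
proof -
  define \<sigma> where "\<sigma> = (\<lambda>s. g s - h s)"
  have c: "continuous_on {0..S} \<sigma>" unfolding \<sigma>_def by (intro continuous_intros g h)
  have "integral {0..S} (\<lambda>s. g s * \<sigma> s - h s * \<sigma> s) = integral {0..S} (\<lambda>s. g s * \<sigma> s) - integral {0..S} (\<lambda>s. h s * \<sigma> s)"
    by (intro integral_diff integrable_continuous_real continuous_intros g h c)
  also have "\<dots> = 0" using eq[OF absolutely_integrable_continuous_real[OF c]] by simp
  finally have "integral {0..S} (\<lambda>s. \<sigma> s * \<sigma> s) = 0" by (simp add: \<sigma>_def left_diff_distrib)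
  moreover have "integral (cbox 0 S) (\<lambda>s. \<sigma> s * \<sigma> s) = 0 \<longleftrightarrow> (\<forall>x\<in>cbox 0 S. \<sigma> x * \<sigma> x = 0)"
    by (rule integral_cbox_eq_0_iff) (use S c in \<open>auto intro!: continuous_intros\<close>)
  ultimately show ?thesis using s by (simp add: \<sigma>_def)
qed

lemma is_green_continuous:
  assumes "is_green B q S G" "t \<in> {0..S}"
  shows "continuous_on {0..S} (G t)"
  by (rule kernel_section_continuous[OF _ assms(2)]) (use assms(1) in \<open>simp add: is_green_def\<close>)

lemma is_green_bvp_solution_iff:
  assumes G: "is_green B q S G" and \<sigma>: "\<sigma> absolutely_integrable_on {0..S}"
  shows "bvp_solution B q S \<sigma> u \<longleftrightarrow> (\<forall>t\<in>{0..S}. u t = integral {0..S} (\<lambda>s. G t s * \<sigma> s))"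
proof -
  have Gc: "continuous_on ({0..S} \<times> {0..S}) (\<lambda>(t, s). G t s)" using G unfolding is_green_def by blast
  have "bvp_solution B q S \<sigma> u \<longleftrightarrow> (\<forall>t\<in>{0..S}. u t = (LINT s:{0..S}|lebesgue. G t s * \<sigma> s))"
    using G \<sigma> unfolding is_green_def by blast
  then show ?thesis using set_lebesgue_integral_kernel(2)[OF Gc _ \<sigma>] by simp
qed

lemma is_green_solution:
  assumes S: "S > 0" and q: "q absolutely_integrable_on {0..S}"
    and G: "is_green B q S G" and \<sigma>: "\<sigma> absolutely_integrable_on {0..S}"
  obtains u v where "ode S q \<sigma> u v" "bc B (u 0) (v 0) (u S) (v S)"
    "\<And>t. t \<in> {0..S} \<Longrightarrow> u t = integral {0..S} (\<lambda>s. G t s * \<sigma> s)"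
proof -
  define u where "u = (\<lambda>t. integral {0..S} (\<lambda>s. G t s * \<sigma> s))"
  have "bvp_solution B q S \<sigma> u" unfolding is_green_bvp_solution_iff[OF G \<sigma>] by (simp add: u_def)
  then obtain v where "ode S q \<sigma> u v" "bc B (u 0) (v 0) (u S) (v S)"
    unfolding bvp_solution_iff_ode[OF S q \<sigma>] by blast
  then show ?thesis by (rule that) (simp add: u_def)
qed

lemma is_green_representation:
  assumes S: "S > 0" and q: "q absolutely_integrable_on {0..S}"
    and G: "is_green B q S G" and \<sigma>: "\<sigma> absolutely_integrable_on {0..S}"
    and u: "ode S q \<sigma> u v" "bc B (u 0) (v 0) (u S) (v S)" and t: "t \<in> {0..S}"
  shows "u t = integral {0..S} (\<lambda>s. G t s * \<sigma> s)"
proof -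
  have "bvp_solution B q S \<sigma> u" unfolding bvp_solution_iff_ode[OF S q \<sigma>] using u by blast
  then show ?thesis unfolding is_green_bvp_solution_iff[OF G \<sigma>] using t by blast
qed

lemma is_green_unique:
  assumes S: "S > 0" and G: "is_green B q S G" and H: "is_green B q S H" and ts: "t \<in> {0..S}" "s \<in> {0..S}"
  shows "G t s = H t s"
proof (rule kernel_eqI[OF S is_green_continuous[OF G ts(1)] is_green_continuous[OF H ts(1)] _ ts(2)])
  fix \<sigma> :: "real \<Rightarrow> real" assume \<sigma>: "\<sigma> absolutely_integrable_on {0..S}"
  have "bvp_solution B q S \<sigma> (\<lambda>t. integral {0..S} (\<lambda>s. G t s * \<sigma> s))"
    unfolding is_green_bvp_solution_iff[OF G \<sigma>] by simp
  then show "integral {0..S} (\<lambda>s. G t s * \<sigma> s) = integral {0..S} (\<lambda>s. H t s * \<sigma> s)"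
    unfolding is_green_bvp_solution_iff[OF H \<sigma>] using ts(1) by blast
qed

lemma is_green_cong:
  assumes G: "is_green B q S G" and eq: "\<And>t s. t \<in> {0..S} \<Longrightarrow> s \<in> {0..S} \<Longrightarrow> G t s = H t s"
  shows "is_green B q S H"
  unfolding is_green_def
proof (intro conjI allI impI)
  have Gc: "continuous_on ({0..S} \<times> {0..S}) (\<lambda>(t, s). G t s)" using G unfolding is_green_def by blast
  show "continuous_on ({0..S} \<times> {0..S}) (\<lambda>(t, s). H t s)"
    by (rule continuous_on_eq[OF Gc]) (use eq in auto)
  fix \<sigma> u :: "real \<Rightarrow> real" assume \<sigma>: "\<sigma> absolutely_integrable_on {0..S}"
  have "(LINT s:{0..S}|lebesgue. G t s * \<sigma> s) = (LINT s:{0..S}|lebesgue. H t s * \<sigma> s)" if "t \<in> {0..S}" for t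
    by (rule set_lebesgue_integral_cong) (use eq that in auto)
  then show "bvp_solution B q S \<sigma> u = (\<forall>t\<in>{0..S}. u t = (LINT s:{0..S}|lebesgue. H t s * \<sigma> s))"
    using G \<sigma> unfolding is_green_def by simp
qed

lemma is_green_green:
  assumes S: "S > 0" and q: "q absolutely_integrable_on {0..S}" and nonres: "nonresonant B q S"
  shows "is_green B q S (green B q S)"
proof -
  obtain G0 where G0: "is_green B q S G0" using green_exists[OF assms] by blast
  define G where "G = (\<lambda>t s. if (t, s) \<in> {0..S} \<times> {0..S} then G0 t s else 0)"
  have G: "is_green B q S G" by (rule is_green_cong[OF G0]) (simp add: G_def)
  have "\<exists>!G. is_green B q S G \<and> (\<forall>t s. (t, s) \<notin> {0..S} \<times> {0..S} \<longrightarrow> G t s = 0)"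
  proof (rule ex1I[of _ G])
    show "is_green B q S G \<and> (\<forall>t s. (t, s) \<notin> {0..S} \<times> {0..S} \<longrightarrow> G t s = 0)"
      using G by (simp add: G_def)
    fix H assume H: "is_green B q S H \<and> (\<forall>t s. (t, s) \<notin> {0..S} \<times> {0..S} \<longrightarrow> H t s = 0)"
    show "H = G"
    proof (intro ext)
      fix t s show "H t s = G t s"
        using is_green_unique[OF S conjunct1[OF H] G, of t s] conjunct2[OF H]
        by (cases "(t, s) \<in> {0..S} \<times> {0..S}") (auto simp: G_def)
    qed
  qed
  from theI'[OF this] show ?thesis unfolding green_def by blast
qed

section \<open>Reflection and even extension\<close>

lemma has_integral_reflect_about:
  fixes f :: "real \<Rightarrow> real"
  assumes "(f has_integral i) {a..b}"
  shows "((\<lambda>x. f (c - x)) has_integral i) {c - b..c - a}"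
proof -
  have "((\<lambda>x. f ((- 1 :: real) *\<^sub>R x + c)) has_integral (1 / \<bar>- 1 :: real\<bar> ^ DIM(real)) *\<^sub>R i)
      ((\<lambda>x. (1 / (- 1 :: real)) *\<^sub>R x + - ((1 / (- 1 :: real)) *\<^sub>R c)) ` cbox a b)"
    by (rule has_integral_affinity) (use assms in auto)
  moreover have "(\<lambda>x. c - x) ` {a..b} = {c - b..c - a}" by (rule image_diff_atLeastAtMost)
  ultimately show ?thesis by simp
qed

lemma abs_integrable_reflect_about:
  fixes f :: "real \<Rightarrow> real"
  assumes "f absolutely_integrable_on {a..b}"
  shows "(\<lambda>x. f (c - x)) absolutely_integrable_on {c - b..c - a}"
  using assms has_integral_reflect_about[of f _ a b c] has_integral_reflect_about[of "\<lambda>x. \<bar>f x\<bar>" _ a b c]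
  unfolding absolutely_integrable_on_def integrable_on_def by auto

lemma abs_integrable_minus:
  fixes f :: "real \<Rightarrow> real"
  shows "f absolutely_integrable_on A \<Longrightarrow> (\<lambda>x. - f x) absolutely_integrable_on A"
  by (simp add: set_integrable_def)

lemma integral_reflect_about:
  fixes f :: "real \<Rightarrow> real"
  assumes "f integrable_on {a..b}"
  shows "integral {c - b..c - a} (\<lambda>x. f (c - x)) = integral {a..b} f"
  by (rule integral_unique[OF has_integral_reflect_about[OF integrable_integral[OF assms]]])

lemma primitive_restrict:
  assumes "primitive S F f" "S' \<le> S"
  shows "primitive S' F f"
  unfolding primitive_def
proof (intro conjI ballI)
  show "f absolutely_integrable_on {0..S'}"
    by (rule absolutely_integrable_on_subinterval[OF primitiveD(1)[OF assms(1)]]) (use assms(2) in simp)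
  show "F t = F 0 + integral {0..t} f" if "t \<in> {0..S'}" for t
    by (rule primitiveD(2)[OF assms(1)]) (use that assms(2) in simp)
qed

lemma primitive_integral_between:
  assumes "primitive S F f" "0 \<le> x" "x \<le> y" "y \<le> S"
  shows "integral {x..y} f = F y - F x"
proof -
  have "integral {0..x} f + integral {x..y} f = integral {0..y} f"
    using assms by (intro Henstock_Kurzweil_Integration.integral_combine primitiveD(3)[OF assms(1)]) auto
  then show ?thesis using primitiveD(2)[OF assms(1), of x] primitiveD(2)[OF assms(1), of y] assms by simp
qed

text \<open>With \<open>G = F\<close> this extends \<open>F\<close> evenly about \<open>S\<close>. With \<open>G = - F\<close> it is the odd extension, which is
  continuous only if \<open>F\<close> vanishes at \<open>S\<close>.\<close>

lemma primitive_glue_reflected: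
  assumes S: "S \<ge> 0" and F: "primitive S F f" and G: "primitive S G g" and eq: "F S = G S"
  shows "primitive (2 * S) (\<lambda>t. if t \<le> S then F t else G (2 * S - t)) (\<lambda>t. if t \<le> S then f t else - g (2 * S - t))"
    (is "primitive _ ?H ?h")
  unfolding primitive_def
proof (intro conjI ballI)
  have 1: "?h absolutely_integrable_on {0..S}"
    by (rule absolutely_integrable_spike[OF primitiveD(1)[OF F], of "{}"]) auto
  have g: "(\<lambda>t. - g (2 * S - t)) absolutely_integrable_on {2 * S - S..2 * S - 0}"
    by (intro abs_integrable_minus abs_integrable_reflect_about primitiveD(1)[OF G])
  have 2: "?h absolutely_integrable_on {S..2 * S}"
    by (rule absolutely_integrable_spike[where S = "{S}" and f = "\<lambda>t. - g (2 * S - t)"]) (use g in auto)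
  show h: "?h absolutely_integrable_on {0..2 * S}"
    using absolutely_integrable_on_combine[OF 1 2] S by simp
  fix t assume t: "t \<in> {0..2 * S}"
  show "?H t = ?H 0 + integral {0..t} ?h"
  proof (cases "t \<le> S")
    case True
    then have "integral {0..t} ?h = integral {0..t} f"
      by (intro Henstock_Kurzweil_Integration.integral_cong) auto
    then show ?thesis using True S t primitiveD(2)[OF F, of t] by simp
  next
    case False
    have "integral {0..t} ?h = integral {0..S} ?h + integral {S..t} ?h"
      using False S t
      by (intro Henstock_Kurzweil_Integration.integral_combine[symmetric] abs_integrable_subinterval_integrable[OF h]) auto
    also have "integral {0..S} ?h = integral {0..S} f"
      by (intro Henstock_Kurzweil_Integration.integral_cong) auto
    also have "\<dots> = F S - F 0" using primitive_integral_between[OF F, of 0 S] S by simp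
    also have "integral {S..t} ?h = integral {S..t} (\<lambda>t. - g (2 * S - t))"
      by (rule integral_spike[of "{S}"]) auto
    also have "\<dots> = - integral {2 * S - S..2 * S - (2 * S - t)} (\<lambda>t. g (2 * S - t))" by simp
    also have "\<dots> = - integral {2 * S - t..S} g"
      by (subst integral_reflect_about) (use False t primitiveD(1)[OF G] in \<open>auto intro: abs_integrable_subinterval_integrable\<close>)
    also have "\<dots> = G (2 * S - t) - G S"
      using primitive_integral_between[OF G, of "2 * S - t" S] False t by simp
    finally show ?thesis using eq False S by simp
  qed
qed

lemma primitive_reflect:
  assumes F: "primitive S F f"
  shows "primitive S (\<lambda>t. F (S - t)) (\<lambda>t. - f (S - t))"
  unfolding primitive_def
proof (intro conjI ballI)
  have "(\<lambda>t. - f (S - t)) absolutely_integrable_on {S - S..S - 0}"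
    by (intro abs_integrable_minus abs_integrable_reflect_about primitiveD(1)[OF F])
  then show "(\<lambda>t. - f (S - t)) absolutely_integrable_on {0..S}" by simp
  fix t assume t: "t \<in> {0..S}"
  have "integral {0..t} (\<lambda>t. - f (S - t)) = - integral {S - S..S - (S - t)} (\<lambda>t. f (S - t))" by simp
  also have "\<dots> = - integral {S - t..S} f"
    by (subst integral_reflect_about) (use t primitiveD(1)[OF F] in \<open>auto intro: abs_integrable_subinterval_integrable\<close>)
  also have "\<dots> = F (S - t) - F S"
    using primitive_integral_between[OF F, of "S - t" S] t by simp
  finally show "F (S - t) = F (S - 0) + integral {0..t} (\<lambda>t. - f (S - t))" by simp
qed

lemma ode_reflect:
  assumes "ode S q \<sigma> u v"
  shows "ode S (\<lambda>t. q (S - t)) (\<lambda>t. \<sigma> (S - t)) (\<lambda>t. u (S - t)) (\<lambda>t. - v (S - t))"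
  unfolding ode_def
  using primitive_reflect[OF ode_D(1)[OF assms]] primitive_cmult[OF primitive_reflect[OF ode_D(2)[OF assms]], of "-1"]
  by simp

lemma bc_reflect: "bc B u0 v0 u1 v1 \<Longrightarrow> bc B u1 (- v1) u0 (- v0)"
  by (cases B) auto

lemma even_ext_reflect: "even_ext L a (2 * L - t) = even_ext L a t"
  by (cases "t = L") (auto simp: even_ext_def)

lemma even_ext_abs_integrable:
  assumes "L \<ge> 0" "a absolutely_integrable_on {0..L}"
  shows "even_ext L a absolutely_integrable_on {0..2 * L}"
proof -
  have 1: "even_ext L a absolutely_integrable_on {0..L}"
    by (rule absolutely_integrable_spike[OF assms(2), of "{}"]) (auto simp: even_ext_def)
  have "(\<lambda>t. even_ext L a (2 * L - t)) absolutely_integrable_on {2 * L - L..2 * L - 0}"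
    by (rule abs_integrable_reflect_about[OF 1])
  then have "even_ext L a absolutely_integrable_on {L..2 * L}" by (simp add: even_ext_reflect)
  then show ?thesis using absolutely_integrable_on_combine[OF 1] assms(1) by simp
qed

text \<open>For a potential symmetric about the midpoint, if \<open>u\<close> solves the problem with right-hand side \<open>\<sigma> (S - t)\<close>, then
  \<open>u (S - t)\<close> solves it with \<open>\<sigma>\<close>. Representing
  both by \<open>G\<close> compares the two kernels.\<close>

lemma is_green_reflect:
  assumes S: "S > 0" and q: "q absolutely_integrable_on {0..S}" and sym: "\<And>t. q (S - t) = q t"
    and G: "is_green B q S G" and ts: "t \<in> {0..S}" "s \<in> {0..S}"
  shows "G (S - t) (S - s) = G t s"
proof (rule kernel_eqI[OF S _ is_green_continuous[OF G ts(1)] _ ts(2), of "\<lambda>s. G (S - t) (S - s)"])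
  have t': "S - t \<in> {0..S}" using ts by simp
  show "continuous_on {0..S} (\<lambda>s. G (S - t) (S - s))"
    by (rule continuous_on_compose2[OF is_green_continuous[OF G t']]) (auto intro!: continuous_intros)
  fix \<sigma> :: "real \<Rightarrow> real" assume \<sigma>: "\<sigma> absolutely_integrable_on {0..S}"
  have \<sigma>': "(\<lambda>s. \<sigma> (S - s)) absolutely_integrable_on {0..S}"
    using abs_integrable_reflect_about[OF \<sigma>, of S] by simp
  obtain u v where uv: "ode S q (\<lambda>s. \<sigma> (S - s)) u v" "bc B (u 0) (v 0) (u S) (v S)"
    and u: "\<And>t. t \<in> {0..S} \<Longrightarrow> u t = integral {0..S} (\<lambda>s. G t s * \<sigma> (S - s))"
    by (rule is_green_solution[OF S q G \<sigma>']) blast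
  have "ode S q \<sigma> (\<lambda>t. u (S - t)) (\<lambda>t. - v (S - t))"
    using ode_reflect[OF uv(1)] by (simp add: sym)
  then have "u (S - t) = integral {0..S} (\<lambda>s. G t s * \<sigma> s)"
    by (rule is_green_representation[OF S q G \<sigma> _ _ ts(1)]) (use bc_reflect[OF uv(2)] in simp)
  moreover have "integral {S - S..S - 0} (\<lambda>s. G (S - t) (S - s) * \<sigma> (S - (S - s))) = integral {0..S} (\<lambda>s. G (S - t) s * \<sigma> (S - s))"
    using continuous_mult_abs_integrable(1)[OF is_green_continuous[OF G t'] \<sigma>'] set_lebesgue_integral_eq_integral(1)
    by (intro integral_reflect_about[of "\<lambda>s. G (S - t) s * \<sigma> (S - s)"]) blast
  ultimately show "integral {0..S} (\<lambda>s. G (S - t) (S - s) * \<sigma> s) = integral {0..S} (\<lambda>s. G t s * \<sigma> s)"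
    using u[OF t'] by simp
qed

lemma ode_even_extension:
  assumes T: "T \<ge> 0" and ode: "ode T a \<sigma> u v" and v: "v T = 0"
  shows "ode (2 * T) (even_ext T a) (even_ext T \<sigma>) (even_ext T u) (\<lambda>t. if t \<le> T then v t else - v (2 * T - t))"
  unfolding ode_def
proof
  note od = ode_D[OF ode]
  show "primitive (2 * T) (even_ext T u) (\<lambda>t. if t \<le> T then v t else - v (2 * T - t))"
    using primitive_glue_reflected[OF T od(1) od(1)] by (simp add: even_ext_def[abs_def])
  have "primitive (2 * T) (\<lambda>t. if t \<le> T then v t else - 1 * v (2 * T - t))
      (\<lambda>t. if t \<le> T then \<sigma> t - a t * u t else - (- 1 * (\<sigma> (2 * T - t) - a (2 * T - t) * u (2 * T - t))))"
    by (rule primitive_glue_reflected[OF T od(2) primitive_cmult[OF od(2)]]) (simp add: v)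
  then show "primitive (2 * T) (\<lambda>t. if t \<le> T then v t else - v (2 * T - t))
      (\<lambda>t. even_ext T \<sigma> t - even_ext T a t * even_ext T u t)"
    by (rule primitive_cong) (auto simp: even_ext_def)
qed

text \<open>The even extension \<open>u\<close> of a Neumann solution has \<open>u(2T) = u(0)\<close>, and \<open>u'\<close> vanishes at both ends.\<close>

lemma nonresonant_Neumann_of_Periodic:
  assumes T: "T > 0" and a: "a absolutely_integrable_on {0..T}"
    and nonres: "nonresonant Periodic (even_ext T a) (2 * T)"
  shows "nonresonant Neumann a T"
  unfolding nonresonant_def
proof (intro allI impI ballI)
  fix u t assume "bvp_solution Neumann a T (\<lambda>_. 0) u" and t: "t \<in> {0..T}"
  then obtain v where uv: "ode T a (\<lambda>_. 0) u v" "v 0 = 0" "v T = 0"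
    unfolding bvp_solution_iff_ode[OF T a absolutely_integrable_zero] by auto
  have ode: "ode (2 * T) (even_ext T a) (\<lambda>_. 0) (even_ext T u) (\<lambda>t. if t \<le> T then v t else - v (2 * T - t))"
    using ode_even_extension[OF less_imp_le[OF T] uv(1,3)] by (simp add: even_ext_def[of T "\<lambda>_. 0", abs_def])
  have "even_ext T u t = 0"
    by (rule nonresonantD[OF nonres _ even_ext_abs_integrable[OF less_imp_le[OF T] a] ode])
       (use T t uv in \<open>auto simp: even_ext_def\<close>)
  then show "u t = 0" using t by (simp add: even_ext_def)
qed

text \<open>The solution for an even right-hand side is even by uniqueness, which forces the Neumann conditions at 0 and
  \<open>T\<close>; the two representations of its restriction to \<open>[0,T]\<close> are then compared.\<close>

lemma is_green_fold:
  assumes T: "T > 0" and a: "a absolutely_integrable_on {0..T}"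
    and G: "is_green Neumann a T G" and H: "is_green B (even_ext T a) (2 * T) H"
    and ts: "t \<in> {0..T}" "s \<in> {0..T}"
  shows "G t s = H t s + H t (2 * T - s)"
proof (rule kernel_eqI[OF T is_green_continuous[OF G ts(1)] _ _ ts(2), of "\<lambda>s. H t s + H t (2 * T - s)"])
  have T2: "2 * T > 0" and T0: "T \<ge> 0" and t2: "t \<in> {0..2 * T}" using T ts by auto
  note a2 = even_ext_abs_integrable[OF T0 a]
  note Hc = is_green_continuous[OF H t2]
  show "continuous_on {0..T} (\<lambda>s. H t s + H t (2 * T - s))"
    using T by (intro continuous_intros continuous_on_compose2[OF Hc]) auto
  fix \<sigma> :: "real \<Rightarrow> real" assume \<sigma>: "\<sigma> absolutely_integrable_on {0..T}"
  note \<sigma>2 = even_ext_abs_integrable[OF T0 \<sigma>]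
  obtain u v where uv: "ode (2 * T) (even_ext T a) (even_ext T \<sigma>) u v" "bc B (u 0) (v 0) (u (2 * T)) (v (2 * T))"
    and u: "\<And>t. t \<in> {0..2 * T} \<Longrightarrow> u t = integral {0..2 * T} (\<lambda>s. H t s * even_ext T \<sigma> s)"
    by (rule is_green_solution[OF T2 a2 H \<sigma>2]) blast
  have ref: "ode (2 * T) (even_ext T a) (even_ext T \<sigma>) (\<lambda>t. u (2 * T - t)) (\<lambda>t. - v (2 * T - t))"
    using ode_reflect[OF uv(1)] by (simp add: even_ext_reflect)
  have "u (2 * T - r) = u r" if r: "r \<in> {0..2 * T}" for r
    using is_green_representation[OF T2 a2 H \<sigma>2 ref _ r] bc_reflect[OF uv(2)] u[OF r] by simp
  then have "ode (2 * T) (even_ext T a) (even_ext T \<sigma>) u (\<lambda>t. - v (2 * T - t))"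
    by (intro ode_cong[OF ref]) auto
  \<comment> \<open>\<open>u\<close> equals its own reflection, so the two expressions for its derivative agree.\<close>
  then have odd: "v r = - v (2 * T - r)" if "r \<in> {0..2 * T}" for r
    by (rule ode_derivative_unique[OF T2 uv(1) _ that])
  have "v T = 0" using odd[of T] T by simp
  moreover have "v 0 = 0" using odd[of 0] uv(2) T by (cases B) auto
  moreover have "ode T a \<sigma> u v"
    unfolding ode_def
  proof
    show "primitive T u v" by (rule primitive_restrict[OF ode_D(1)[OF uv(1)]]) (use T in simp)
    have "primitive T v (\<lambda>t. even_ext T \<sigma> t - even_ext T a t * u t)"
      by (rule primitive_restrict[OF ode_D(2)[OF uv(1)]]) (use T in simp)
    then show "primitive T v (\<lambda>t. \<sigma> t - a t * u t)" by (rule primitive_cong) (auto simp: even_ext_def)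
  qed
  ultimately have "u t = integral {0..T} (\<lambda>s. G t s * \<sigma> s)"
    by (intro is_green_representation[OF T a G \<sigma> _ _ ts(1), of u v]) auto
  moreover have "u t = integral {0..T} (\<lambda>s. (H t s + H t (2 * T - s)) * \<sigma> s)"
  proof -
    define h where "h = (\<lambda>s. H t s * even_ext T \<sigma> s)"
    have h: "h integrable_on {x..y}" if "0 \<le> x" "y \<le> 2 * T" for x y
      unfolding h_def
      by (rule abs_integrable_subinterval_integrable[OF continuous_mult_abs_integrable(1)[OF Hc \<sigma>2]]) (use that in simp)
    have "u t = integral {0..T} h + integral {T..2 * T} h"
      using u[OF t2] Henstock_Kurzweil_Integration.integral_combine[OF T0 _ h[of 0 "2 * T"]] T by (simp add: h_def)
    also have "integral {T..2 * T} h = integral {2 * T - 2 * T..2 * T - T} (\<lambda>s. h (2 * T - s))"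
      by (rule integral_reflect_about[symmetric]) (use h T in simp)
    also have "\<dots> = integral {0..T} (\<lambda>s. h (2 * T - s))" by simp
    also have "integral {0..T} h + integral {0..T} (\<lambda>s. h (2 * T - s)) = integral {0..T} (\<lambda>s. h s + h (2 * T - s))"
    proof (rule integral_add[symmetric])
      show "h integrable_on {0..T}" using h T by simp
      have "h integrable_on {T..2 * T}" using h T by simp
      from has_integral_reflect_about[OF integrable_integral[OF this], of "2 * T"]
      show "(\<lambda>s. h (2 * T - s)) integrable_on {0..T}" by (auto simp: has_integral_integrable)
    qed
    also have "\<dots> = integral {0..T} (\<lambda>s. (H t s + H t (2 * T - s)) * \<sigma> s)"
    proof (rule Henstock_Kurzweil_Integration.integral_cong)
      fix s assume "s \<in> {0..T}"
      then have "even_ext T \<sigma> s = \<sigma> s" by (simp add: even_ext_def)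
      then show "h s + h (2 * T - s) = (H t s + H t (2 * T - s)) * \<sigma> s"
        unfolding h_def even_ext_reflect by (simp add: distrib_right)
    qed
    finally show ?thesis .
  qed
  ultimately show "integral {0..T} (\<lambda>s. G t s * \<sigma> s) = integral {0..T} (\<lambda>s. (H t s + H t (2 * T - s)) * \<sigma> s)" by simp
qed

lemma green_reflect:
  assumes T: "T > 0" and a: "a absolutely_integrable_on {0..T}"
    and nonres: "nonresonant B (even_ext T a) (2 * T)" and ts: "t \<in> {0..2 * T}" "s \<in> {0..2 * T}"
  shows "green B (even_ext T a) (2 * T) (2 * T - t) (2 * T - s) = green B (even_ext T a) (2 * T) t s"
proof -
  have T2: "2 * T > 0" using T by simp
  note a2 = even_ext_abs_integrable[OF less_imp_le[OF T] a]
  show ?thesis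
    by (rule is_green_reflect[OF T2 a2 even_ext_reflect is_green_green[OF T2 a2 nonres] ts])
qed

lemma green_fold:
  assumes T: "T > 0" and a: "a absolutely_integrable_on {0..T}" and N: "nonresonant Neumann a T"
    and nonres: "nonresonant B (even_ext T a) (2 * T)" and ts: "t \<in> {0..T}" "s \<in> {0..T}"
  shows "green Neumann a T t s = green B (even_ext T a) (2 * T) t s + green B (even_ext T a) (2 * T) t (2 * T - s)"
    and "green Neumann a T t s = green B (even_ext T a) (2 * T) t s + green B (even_ext T a) (2 * T) (2 * T - t) s"
proof -
  have T2: "2 * T > 0" using T by simp
  note a2 = even_ext_abs_integrable[OF less_imp_le[OF T] a]
  show 1: "green Neumann a T t s = green B (even_ext T a) (2 * T) t s + green B (even_ext T a) (2 * T) t (2 * T - s)"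
    by (rule is_green_fold[OF T a is_green_green[OF T a N] is_green_green[OF T2 a2 nonres] ts])
  have "green B (even_ext T a) (2 * T) t (2 * T - s) = green B (even_ext T a) (2 * T) (2 * T - t) s"
    using green_reflect[OF T a nonres, of t "2 * T - s"] ts by simp
  with 1 show "green Neumann a T t s = green B (even_ext T a) (2 * T) t s + green B (even_ext T a) (2 * T) (2 * T - t) s"
    by simp
qed

theorem mainTheorem1:
  fixes T :: real and a a2 a4 :: "real \<Rightarrow> real"
  assumes "T > 0"
    and "a absolutely_integrable_on {0..T}"
  defines "a2 \<equiv> even_ext T a"
    and "a4 \<equiv> even_ext (2 * T) (even_ext T a)"
  shows
    "(nonresonant Neumann a T \<longrightarrow> nonresonant Periodic a2 (2 * T) \<longrightarrow>
       (\<forall>t\<in>{0..T}. \<forall>s\<in>{0..T}. green Neumann a T t s =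
          green Periodic a2 (2 * T) t s + green Periodic a2 (2 * T) t (2 * T - s))) \<and>
     (nonresonant Periodic a2 (2 * T) \<longrightarrow>
       (\<forall>t\<in>{0..2 * T}. \<forall>s\<in>{0..2 * T}. green Periodic a2 (2 * T) t s =
          green Periodic a2 (2 * T) (2 * T - t) (2 * T - s))) \<and>
     (nonresonant Neumann a T \<longrightarrow> nonresonant Periodic a2 (2 * T) \<longrightarrow>
       (\<forall>t\<in>{0..T}. \<forall>s\<in>{0..T}. green Neumann a T t s =
          green Periodic a2 (2 * T) t s + green Periodic a2 (2 * T) (2 * T - t) s)) \<and>
     (nonresonant Neumann a T \<longrightarrow> nonresonant Neumann a2 (2 * T) \<longrightarrow>
       (\<forall>t\<in>{0..T}. \<forall>s\<in>{0..T}. green Neumann a T t s =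
          green Neumann a2 (2 * T) t s + green Neumann a2 (2 * T) (2 * T - t) s)) \<and>
     (nonresonant Neumann a T \<longrightarrow> nonresonant Periodic a4 (4 * T) \<longrightarrow>
       (\<forall>t\<in>{0..T}. \<forall>s\<in>{0..T}. green Neumann a T t s =
          green Periodic a4 (4 * T) t s + green Periodic a4 (4 * T) (4 * T - t) s +
          green Periodic a4 (4 * T) (2 * T - t) s + green Periodic a4 (4 * T) (2 * T + t) s))"
proof (intro conjI impI ballI)
  fix t s
  assume N: "nonresonant Neumann a T" and ts: "t \<in> {0..T}" "s \<in> {0..T}"
  show "green Neumann a T t s = green Periodic a2 (2 * T) t s + green Periodic a2 (2 * T) t (2 * T - s)"
    and "green Neumann a T t s = green Periodic a2 (2 * T) t s + green Periodic a2 (2 * T) (2 * T - t) s"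
    if "nonresonant Periodic a2 (2 * T)"
    using green_fold[OF assms(1,2) N that[unfolded a2_def] ts] unfolding a2_def by blast+
  show "green Neumann a T t s = green Neumann a2 (2 * T) t s + green Neumann a2 (2 * T) (2 * T - t) s"
    if "nonresonant Neumann a2 (2 * T)"
    using green_fold(2)[OF assms(1,2) N that[unfolded a2_def] ts] unfolding a2_def .
  assume "nonresonant Periodic a4 (4 * T)"
  then have P4: "nonresonant Periodic (even_ext (2 * T) (even_ext T a)) (2 * (2 * T))" by (simp add: a4_def)
  have T2: "2 * T > 0" using assms(1) by simp
  note a2i = even_ext_abs_integrable[OF less_imp_le[OF assms(1)] assms(2)]
  \<comment> \<open>The last identity passes through this problem, whose nonresonance is inherited from the problem on \<open>[0,4T]\<close>.\<close>
  have N2: "nonresonant Neumann (even_ext T a) (2 * T)"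
    by (rule nonresonant_Neumann_of_Periodic[OF T2 a2i P4])
  have fold4: "green Neumann (even_ext T a) (2 * T) r s = green Periodic a4 (4 * T) r s + green Periodic a4 (4 * T) (4 * T - r) s"
    if "r \<in> {0..2 * T}" for r
    using green_fold(2)[OF T2 a2i N2 P4 that, of s] ts by (simp add: a4_def)
  show "green Neumann a T t s = green Periodic a4 (4 * T) t s + green Periodic a4 (4 * T) (4 * T - t) s +
      green Periodic a4 (4 * T) (2 * T - t) s + green Periodic a4 (4 * T) (2 * T + t) s"
    using green_fold(2)[OF assms(1,2) N N2 ts] fold4[of t] fold4[of "2 * T - t"] ts by (simp add: add_ac)
next
  fix t s
  assume "nonresonant Periodic a2 (2 * T)" "t \<in> {0..2 * T}" "s \<in> {0..2 * T}"
  then show "green Periodic a2 (2 * T) t s = green Periodic a2 (2 * T) (2 * T - t) (2 * T - s)"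
    using green_reflect[OF assms(1,2)] unfolding a2_def by simp
qed

end
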